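(* Suppose data points lie on the unit half-circle $\{(\cos\theta,\sin\theta)\in\mathbb{R}^2 : \theta\in[-\pi/2,\pi/2]\}$ and are uniformly distributed on it, and there are two classes separated by the $x$-axis (points with $\theta>0$ form one class and points with $\theta<0$ the other). Let $\mathcal{T}_0$ be an initial labeled sample consisting of $m$ samples from each class, and let $\mathcal{Z}$ be a candidate set drawn from the same distribution. Let the learner $H$ be a linear SVM whose decision boundary passes through the origin. Suppose min-margin sampling is run with bootstrap sample size fraction $\beta\ge \frac{1}{m}$ and that its learned models $\{h_1,\dots,h_K\}$ span all possible models obtainable from a stratified bootstrap sample of $\mathcal{T}_0$. Suppose that $$|\mathcal{Z}|\ge 12B\cdot m,\qquad B\ge 3m^2\log(m),\qquad m\ge 100.$$ For $S\subseteq\mathcal{Z}$ define $\Theta^*(S):=\min\{\theta^2 : (\cos\theta,\sin\theta)\in S,\ \theta\in[-\pi/2,\pi/2]\}$, i.e. the squared angle (with respect to the positive $x$-axis) of the example of $S$ closest to the true decision boundary. Let $S_{\text{margin}},S_{\text{min-margin}}\subseteq\mathcal{Z}$ be the batches of size $B$ chosen by margin sampling and by min-margin sampling respectively. Then $$\mathbb{E}[\Theta^*(S_{\text{min-margin}})]<\mathbb{E}[\Theta^*(S_{\text{margin}})].$$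
   Context: Setting: a labeled training set $\mathcal{T}_0=\{(x_i,y_i)\}_{i=1}^N$ with $N_g$ examples of class $g$, a candidate set $\mathcal{Z}$, and a learning procedure $H$ that maps a training set $\mathcal{T}$ to a model $h=H(\mathcal{T})$ with class discriminant functions $h(z;g)$. The margin of $h$ at $z$ is $\mathrm{margin}(h,z)=h(z;\hat y_1(z))-h(z;\hat y_2(z))$, where $\hat y_1(z)=\arg\max_g h(z;g)$ and $\hat y_2(z)=\arg\max_{g\ne\hat y_1(z)}h(z;g)$. Margin sampling: train $h=H(\mathcal{T}_0)$ and return the $B$ candidates $z\in\mathcal{Z}$ with smallest $\mathrm{margin}(h,z)$. Min-margin sampling with parameters $K$ (number of bootstrap models) and $\beta$ (bootstrap sample size fraction): for each $k=1,\dots,K$, let $\mathcal{T}_k$ be a random sample with replacement from $\mathcal{T}_0$ consisting of $\lfloor\beta N_g\rfloor$ examples from each class $g$ (stratified bootstrap sample), and $h_k=H(\mathcal{T}_k)$; score each $z\in\mathcal{Z}$ by $\min_{k\in[K]}\mathrm{margin}(h_k,z)$ and return the $B$ candidates with lowest score. A linear SVM on linearly separable binary data learns a linear decision boundary (here constrained to pass through the origin) that correctly separates the two classes and maximizes the minimum distance of any training example to the boundary. Expectations are over the random draws of $\mathcal{T}_0$ and $\mathcal{Z}$. *)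

theory Defs
  imports "HOL-Probability.Probability"
begin

definition pt :: "real \<Rightarrow> real \<times> real" where
  "pt \<theta> = (cos \<theta>, sin \<theta>)"

text \<open>A linear model through the origin is given by a unit normal vector w.
  Class True is the class of points with positive angle.  The class
  discriminant functions are the signed distances to the boundary.\<close>
definition disc :: "real \<times> real \<Rightarrow> real \<times> real \<Rightarrow> bool \<Rightarrow> real" where
  "disc w z g = (if g then w \<bullet> z else - (w \<bullet> z))"

text \<open>margin(h,z) = h(z; yhat1) - h(z; yhat2); for two classes this is the
  absolute difference of the two discriminant values.\<close>
definition margin :: "real \<times> real \<Rightarrow> real \<times> real \<Rightarrow> real" where
  "margin w z = \<bar>disc w z True - disc w z False\<bar>"

definition geo_margin :: "real \<times> real \<Rightarrow> ((real \<times> real) \<times> bool) list \<Rightarrow> real" where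
  "geo_margin w T = Min ((\<lambda>(x, y). disc w x y) ` set T)"

definition svm :: "((real \<times> real) \<times> bool) list \<Rightarrow> real \<times> real" where
  "svm T = (SOME w. norm w = 1 \<and>
      (\<forall>w'. norm w' = 1 \<longrightarrow> geo_margin w' T \<le> geo_margin w T))"

definition train_set :: "nat \<Rightarrow> (nat \<Rightarrow> real) \<Rightarrow> (nat \<Rightarrow> real) \<Rightarrow> ((real \<times> real) \<times> bool) list" where
  "train_set m p q = map (\<lambda>i. (pt (p i), True)) [0..<m] @ map (\<lambda>i. (pt (q i), False)) [0..<m]"

text \<open>Stratified bootstrap sample: k draws (indices f, with replacement) from
  the positive class and k draws (indices g) from the negative class.\<close>
definition boot_set :: "nat \<Rightarrow> (nat \<Rightarrow> real) \<Rightarrow> (nat \<Rightarrow> real) \<Rightarrow> (nat \<Rightarrow> nat) \<Rightarrow> (nat \<Rightarrow> nat)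
     \<Rightarrow> ((real \<times> real) \<times> bool) list" where
  "boot_set k p q f g = map (\<lambda>j. (pt (p (f j)), True)) [0..<k] @ map (\<lambda>j. (pt (q (g j)), False)) [0..<k]"

definition boot_models :: "nat \<Rightarrow> real \<Rightarrow> (nat \<Rightarrow> real) \<Rightarrow> (nat \<Rightarrow> real) \<Rightarrow> (real \<times> real) set" where
  "boot_models m \<beta> p q =
     (let k = nat \<lfloor>\<beta> * real m\<rfloor> in
      {svm (boot_set k p q f g) | f g. f \<in> {..<k} \<rightarrow>\<^sub>E {..<m} \<and> g \<in> {..<k} \<rightarrow>\<^sub>E {..<m}})"

definition margin_score :: "nat \<Rightarrow> (nat \<Rightarrow> real) \<Rightarrow> (nat \<Rightarrow> real) \<Rightarrow> real \<Rightarrow> real" where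
  "margin_score m p q \<theta> = margin (svm (train_set m p q)) (pt \<theta>)"

definition min_margin_score :: "nat \<Rightarrow> real \<Rightarrow> (nat \<Rightarrow> real) \<Rightarrow> (nat \<Rightarrow> real) \<Rightarrow> real \<Rightarrow> real" where
  "min_margin_score m \<beta> p q \<theta> = Min ((\<lambda>w. margin w (pt \<theta>)) ` boot_models m \<beta> p q)"

text \<open>Indices of the B candidates (among 0..<n) with lowest score;
  ties (a null event) are broken by index.\<close>
definition select_lowest :: "(nat \<Rightarrow> real) \<Rightarrow> nat \<Rightarrow> nat \<Rightarrow> nat set" where
  "select_lowest s n B =
     {i. i < n \<and> card {j. j < n \<and> (s j < s i \<or> (s j = s i \<and> j < i))} < B}"

definition Theta_star :: "(nat \<Rightarrow> real) \<Rightarrow> nat set \<Rightarrow> real" where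
  "Theta_star z S = Min ((\<lambda>i. (z i)\<^sup>2) ` S)"

definition data_measure :: "nat \<Rightarrow> nat \<Rightarrow> ((nat \<Rightarrow> real) \<times> ((nat \<Rightarrow> real) \<times> (nat \<Rightarrow> real))) measure" where
  "data_measure m n =
     (PiM {..<m} (\<lambda>_. uniform_measure lborel {0<..pi/2})) \<Otimes>\<^sub>M
     ((PiM {..<m} (\<lambda>_. uniform_measure lborel {-pi/2..<0})) \<Otimes>\<^sub>M
      (PiM {..<n} (\<lambda>_. uniform_measure lborel {-pi/2..pi/2})))"

end

theory Submission
  imports Defs
begin

text \<open>A maximum-margin line through the origin bisects the angle between the two innermost points of
  opposite classes. Margin sampling therefore uses the single direction \<open>\<phi> = (min p + max q) / 2\<close>,
  which is typically of order \<open>1/m\<close> away from the true boundary, while the bootstrap models realise all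
  \<open>m\<^sup>2\<close> directions \<open>(p i + q j) / 2\<close>, some of which are much closer to it.

  Given the training set, the candidates are independent, so exponential moments control how many of
  them fall near a direction. With overwhelming probability the \<open>B\<close> candidates chosen by margin sampling
  lie within \<open>O(1/m)\<close> of \<open>\<phi>\<close>, with a constant small enough not to compensate the error of \<open>\<phi>\<close>. For
  min-margin sampling take \<open>d = 9 \<pi> B / (20 n m\<^sup>2)\<close>: the \<open>d\<close>-neighbourhoods of all \<open>m\<^sup>2\<close> directions together
  hold fewer than \<open>B\<close> candidates, hence every candidate within \<open>d\<close> of some direction is selected, and a
  prescribed direction has such a candidate except with probability
  \<open>exp (- 9 B / (10 m\<^sup>2)) \<le> m powr (- 27/10)\<close>.

  With \<open>X = (m + 1) (m + 2)\<close>, the two expectations are then at most \<open>0.19 (\<pi>/2)\<^sup>2 / X\<close> and at least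
  \<open>0.1949 (\<pi>/2)\<^sup>2 / X\<close>. Only explicit measurable bounds of \<open>\<Theta>\<^sup>*\<close> are integrated, so the
  measurability of \<open>\<Theta>\<^sup>*\<close> itself plays no role.\<close>

subsection \<open>Maximum-margin directions and selected candidates\<close>

text \<open>The unit normal of the line through the origin and \<open>pt \<phi>\<close>, oriented
  toward larger angles, so a linear model is encoded by the angle of its boundary.\<close>

definition normal_at :: "real \<Rightarrow> real \<times> real" where
  "normal_at \<phi> = (- sin \<phi>, cos \<phi>)"

lemma norm_normal_at [simp]: "norm (normal_at \<phi>) = 1"
  by (simp add: normal_at_def norm_Pair)

lemma normal_at_inner_pt: "normal_at \<phi> \<bullet> pt \<theta> = sin (\<theta> - \<phi>)"
  by (simp add: normal_at_def pt_def sin_diff algebra_simps)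

lemma margin_normal_at: "margin (normal_at \<phi>) (pt \<theta>) = 2 * \<bar>sin (\<theta> - \<phi>)\<bar>"
  by (simp add: margin_def disc_def normal_at_inner_pt)

text \<open>A chord of the circle is perpendicular to the bisector of its endpoints. This is what
  makes the maximum-margin boundary bisect the two innermost points.\<close>

lemma pt_diff: "pt P - pt Q = (2 * sin ((P - Q) / 2)) *\<^sub>R normal_at ((P + Q) / 2)"
proof -
  have "cos P - cos Q = - (2 * sin ((P - Q) / 2)) * sin ((P + Q) / 2)"
    using cos_diff_cos[of P Q] by (simp add: minus_diff_eq[of P Q, symmetric] del: minus_diff_eq)
  moreover have "sin P - sin Q = (2 * sin ((P - Q) / 2)) * cos ((P + Q) / 2)"
    by (simp add: sin_diff_sin)
  ultimately show ?thesis by (simp add: pt_def normal_at_def)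
qed

text \<open>The equality case of Cauchy-Schwarz, needed for uniqueness of the maximum-margin
  normal.\<close>

lemma unit_vectors_eq:
  fixes u v :: "'a::real_inner"
  assumes "norm u = 1" "norm v = 1" "u \<bullet> v \<ge> 1"
  shows "u = v"
proof -
  have "(norm (u - v))\<^sup>2 = 2 - 2 * (u \<bullet> v)"
    using assms by (simp add: power2_norm_eq_inner inner_diff inner_commute norm_eq_1)
  then have "(norm (u - v))\<^sup>2 \<le> 0" using assms by simp
  then show ?thesis by simp
qed

lemma sin_ge_between:
  fixes x d :: real
  assumes "0 \<le> d" "d \<le> x" "x \<le> pi - d"
  shows "sin d \<le> sin x"
proof (cases "x \<le> pi / 2")
  case True
  then show ?thesis using assms by (intro sin_monotone_2pi_le) auto
next
  case False
  have "sin d \<le> sin (pi - x)" using assms False by (intro sin_monotone_2pi_le) auto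
  then show ?thesis by simp
qed

text \<open>Averaging the constraints at the innermost points \<open>P\<close> and \<open>Q\<close>
  bounds every geometric margin by \<open>sin \<delta>\<close> times the cosine of the angle to the
  bisecting normal. That normal attains \<open>sin \<delta>\<close> on all points, and equality
  forces any other optimal normal to coincide with it.\<close>

lemma svm_eq:
  assumes T: "set T = (\<lambda>a. (pt a, True)) ` A \<union> (\<lambda>b. (pt b, False)) ` C"
    and fin: "finite A" "finite C"
    and P: "P \<in> A" "0 < P" "\<And>a. a \<in> A \<Longrightarrow> P \<le> a \<and> a \<le> pi / 2"
    and Q: "Q \<in> C" "Q < 0" "\<And>b. b \<in> C \<Longrightarrow> - pi / 2 \<le> b \<and> b \<le> Q"
  shows "svm T = normal_at ((P + Q) / 2)"
proof -
  define w0 where "w0 = normal_at ((P + Q) / 2)"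
  define \<delta> where "\<delta> = (P - Q) / 2"
  have Pb: "P \<le> pi / 2" and Qb: "- pi / 2 \<le> Q" using P Q by auto
  have \<delta>: "0 < \<delta>" "\<delta> \<le> pi / 2" using P(2) Q(2) Pb Qb by (auto simp: \<delta>_def)
  have s\<delta>: "sin \<delta> > 0" using \<delta> by (intro sin_gt_zero) auto
  have fT: "finite ((\<lambda>(x, y). disc w x y) ` set T)" for w by simp
  have ub: "geo_margin w T \<le> sin \<delta> * (w0 \<bullet> w)" for w
  proof -
    have "geo_margin w T \<le> w \<bullet> pt P"
      unfolding geo_margin_def using P(1) by (intro Min_le[OF fT]) (force simp: T disc_def)
    moreover have "geo_margin w T \<le> - (w \<bullet> pt Q)"
      unfolding geo_margin_def using Q(1) by (intro Min_le[OF fT]) (force simp: T disc_def)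
    ultimately have "2 * geo_margin w T \<le> w \<bullet> (pt P - pt Q)" by (simp add: inner_diff_right)
    also have "\<dots> = 2 * (sin \<delta> * (w0 \<bullet> w))"
      by (simp only: pt_diff w0_def \<delta>_def inner_scaleR_right inner_commute[of w] mult.assoc)
    finally show ?thesis by simp
  qed
  have "geo_margin w0 T \<ge> sin \<delta>"
    unfolding geo_margin_def
  proof (subst Min_ge_iff[OF fT])
    show "(\<lambda>(x, y). disc w0 x y) ` set T \<noteq> {}" using P(1) by (auto simp: T)
    \<comment> \<open>The argument must stay in \<open>[\<delta>, pi - \<delta>]\<close>. Its lower
      end is \<open>P \<le> a\<close>; its upper end reduces to \<open>a \<le> pi + Q\<close>, which
      follows from \<open>a \<le> pi/2\<close> and \<open>Q \<ge> - pi/2\<close>.\<close>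
    have "sin \<delta> \<le> sin (a - (P + Q) / 2)" if "a \<in> A" for a
      using P(3)[OF that] Qb \<delta> by (intro sin_ge_between) (auto simp: \<delta>_def field_simps)
    moreover have "sin \<delta> \<le> - sin (b - (P + Q) / 2)" if "b \<in> C" for b
    proof -
      have "sin \<delta> \<le> sin ((P + Q) / 2 - b)"
        using Q(3)[OF that] Pb \<delta> by (intro sin_ge_between) (auto simp: \<delta>_def field_simps)
      then show ?thesis by (metis minus_diff_eq sin_minus)
    qed
    ultimately show "\<forall>a\<in>(\<lambda>(x, y). disc w0 x y) ` set T. sin \<delta> \<le> a"
      by (auto simp: T disc_def w0_def normal_at_inner_pt)
  qed
  moreover have "geo_margin w T \<le> sin \<delta>" if "norm w = 1" for w
  proof -
    have "w0 \<bullet> w \<le> 1" using norm_cauchy_schwarz[of w0 w] that by (simp add: w0_def)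
    then have "sin \<delta> * (w0 \<bullet> w) \<le> sin \<delta>" using s\<delta> by simp
    with ub[of w] show ?thesis by simp
  qed
  \<comment> \<open>\<open>svm\<close> is a choice by \<open>SOME\<close>, so existence of a
    maximiser is not enough: the maximiser has to be unique.\<close>
  moreover have "w = w0" if "norm w = 1" "geo_margin w T \<ge> sin \<delta>" for w
  proof -
    have "sin \<delta> * 1 \<le> sin \<delta> * (w0 \<bullet> w)" using that ub[of w] by simp
    then have "1 \<le> w0 \<bullet> w" using s\<delta> by (simp only: mult_le_cancel_left_pos)
    then show ?thesis using unit_vectors_eq[of w0 w] that by (simp add: w0_def)
  qed
  moreover have "norm w0 = 1" by (simp add: w0_def)
  ultimately show ?thesis unfolding svm_def w0_def[symmetric]
    by (intro some_equality) (use order.trans in blast)+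
qed

lemma svm_train_set:
  assumes "m > 0" and p: "\<And>i. i < m \<Longrightarrow> p i \<in> {0<..pi/2}" and q: "\<And>i. i < m \<Longrightarrow> q i \<in> {-pi/2..<0}"
  shows "svm (train_set m p q) = normal_at ((Min (p ` {..<m}) + Max (q ` {..<m})) / 2)"
proof (rule svm_eq[where A = "p ` {..<m}" and C = "q ` {..<m}"])
  have ne: "p ` {..<m} \<noteq> {}" "q ` {..<m} \<noteq> {}" using assms(1) by auto
  show Pin: "Min (p ` {..<m}) \<in> p ` {..<m}" using ne by (intro Min_in) auto
  show Qin: "Max (q ` {..<m}) \<in> q ` {..<m}" using ne by (intro Max_in) auto
  show "0 < Min (p ` {..<m})" using Pin p by fastforce
  show "Max (q ` {..<m}) < 0" using Qin q by fastforce
  show "Min (p ` {..<m}) \<le> a \<and> a \<le> pi / 2" if "a \<in> p ` {..<m}" for a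
    using that p by (auto intro: Min_le)
  show "- pi / 2 \<le> b \<and> b \<le> Max (q ` {..<m})" if "b \<in> q ` {..<m}" for b
    using that q by (auto intro: Max_ge)
qed (auto simp: train_set_def image_image)

text \<open>A bootstrap model depends only on the innermost drawn point of each class, so it is the
  bisector of some pair. Conversely, drawing one index repeatedly in each class isolates any
  prescribed pair. The bound on \<open>\<beta>\<close> makes the bootstrap size at least
  one.\<close>

lemma boot_models_eq:
  assumes "\<beta> \<ge> 1 / real m" "m > 0"
    and p: "\<And>i. i < m \<Longrightarrow> p i \<in> {0<..pi/2}" and q: "\<And>i. i < m \<Longrightarrow> q i \<in> {-pi/2..<0}"
  shows "boot_models m \<beta> p q = (\<lambda>(i, j). normal_at ((p i + q j) / 2)) ` ({..<m} \<times> {..<m})"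
proof -
  define k where "k = nat \<lfloor>\<beta> * real m\<rfloor>"
  have "1 \<le> \<beta> * real m" using assms(1,2) by (simp add: field_simps)
  then have "k \<ge> 1" by (simp add: k_def le_nat_iff le_floor_iff)
  then have k: "{..<k} \<noteq> {}" by (auto simp: lessThan_empty_iff)
  have svm_boot: "svm (boot_set k p q f g) = normal_at ((p i + q j) / 2)"
    if "i \<in> f ` {..<k}" "j \<in> g ` {..<k}" "f ` {..<k} \<subseteq> {..<m}" "g ` {..<k} \<subseteq> {..<m}"
      "\<And>i'. i' \<in> f ` {..<k} \<Longrightarrow> p i \<le> p i'" "\<And>j'. j' \<in> g ` {..<k} \<Longrightarrow> q j' \<le> q j" for f g i j
  proof (rule svm_eq[where A = "p ` f ` {..<k}" and C = "q ` g ` {..<k}"])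
    have "i < m" "j < m" using that by auto
    then show "0 < p i" "q j < 0" using p q by force+
    show "p i \<le> a \<and> a \<le> pi / 2" if a: "a \<in> p ` f ` {..<k}" for a
    proof -
      obtain i' where "a = p i'" "i' \<in> f ` {..<k}" using a by blast
      then show ?thesis using \<open>f ` {..<k} \<subseteq> {..<m}\<close> p[of i'] \<open>\<And>i'. i' \<in> f ` {..<k} \<Longrightarrow> p i \<le> p i'\<close> by auto
    qed
    show "- pi / 2 \<le> b \<and> b \<le> q j" if b: "b \<in> q ` g ` {..<k}" for b
    proof -
      obtain j' where "b = q j'" "j' \<in> g ` {..<k}" using b by blast
      then show ?thesis using \<open>g ` {..<k} \<subseteq> {..<m}\<close> q[of j'] \<open>\<And>j'. j' \<in> g ` {..<k} \<Longrightarrow> q j' \<le> q j\<close> by auto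
    qed
  qed (use that in \<open>auto simp: boot_set_def image_image\<close>)
  show ?thesis
  proof (intro equalityI subsetI)
    fix w assume "w \<in> boot_models m \<beta> p q"
    then obtain f g where fg: "w = svm (boot_set k p q f g)"
      "f \<in> {..<k} \<rightarrow>\<^sub>E {..<m}" "g \<in> {..<k} \<rightarrow>\<^sub>E {..<m}"
      by (auto simp: boot_models_def k_def[symmetric] Let_def)
    have sub: "f ` {..<k} \<subseteq> {..<m}" "g ` {..<k} \<subseteq> {..<m}" using fg by auto
    have "\<exists>i\<in>f ` {..<k}. \<forall>i'\<in>f ` {..<k}. p i \<le> p i'"
    proof -
      have "Min (p ` f ` {..<k}) \<in> p ` f ` {..<k}" using k by (intro Min_in) auto
      then obtain i where "i \<in> f ` {..<k}" "p i = Min (p ` f ` {..<k})" by (metis imageE)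
      then show ?thesis by (intro bexI[of _ i]) auto
    qed
    moreover have "\<exists>j\<in>g ` {..<k}. \<forall>j'\<in>g ` {..<k}. q j' \<le> q j"
    proof -
      have "Max (q ` g ` {..<k}) \<in> q ` g ` {..<k}" using k by (intro Max_in) auto
      then obtain i where "i \<in> g ` {..<k}" "q i = Max (q ` g ` {..<k})" by (metis imageE)
      then show ?thesis by (intro bexI[of _ i]) auto
    qed
    ultimately obtain i j where ij: "i \<in> f ` {..<k}" "j \<in> g ` {..<k}"
      "\<And>i'. i' \<in> f ` {..<k} \<Longrightarrow> p i \<le> p i'" "\<And>j'. j' \<in> g ` {..<k} \<Longrightarrow> q j' \<le> q j" by blast
    have "w = normal_at ((p i + q j) / 2)" unfolding fg(1) using ij sub by (intro svm_boot) auto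
    moreover have "(i, j) \<in> {..<m} \<times> {..<m}" using ij sub by auto
    ultimately show "w \<in> (\<lambda>(i, j). normal_at ((p i + q j) / 2)) ` ({..<m} \<times> {..<m})"
      by force
  next
    fix w assume "w \<in> (\<lambda>(i, j). normal_at ((p i + q j) / 2)) ` ({..<m} \<times> {..<m})"
    then obtain i j where ij: "i < m" "j < m" "w = normal_at ((p i + q j) / 2)" by auto
    \<comment> \<open>Constant draws realise the pair; \<open>restrict\<close> makes them
      extensional, as membership in the function space requires.\<close>
    define f where "f = restrict (\<lambda>_. i) {..<k}"
    define g where "g = restrict (\<lambda>_. j) {..<k}"
    have im: "f ` {..<k} = {i}" "g ` {..<k} = {j}" using k by (auto simp: f_def g_def)
    have "w = svm (boot_set k p q f g)" unfolding ij(3) using ij im by (intro svm_boot[symmetric]) auto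
    moreover have "f \<in> {..<k} \<rightarrow>\<^sub>E {..<m}" "g \<in> {..<k} \<rightarrow>\<^sub>E {..<m}"
      using ij by (auto simp: f_def g_def)
    ultimately show "w \<in> boot_models m \<beta> p q"
      by (auto simp: boot_models_def k_def[symmetric] Let_def)
  qed
qed

text \<open>Converts score thresholds into angular distances. The range \<open>3 * pi / 4\<close> is
  the sum of the largest candidate angle \<open>pi/2\<close> and the largest boundary angle
  \<open>pi/4\<close>; past \<open>pi/2\<close> the sine decreases but stays at least
  \<open>sin (pi/4)\<close>, hence above \<open>sin d\<close>.\<close>

lemma abs_sin_le_iff:
  fixes x d :: real
  assumes "\<bar>x\<bar> \<le> 3 * pi / 4" "0 \<le> d" "d < pi / 4"
  shows "\<bar>sin x\<bar> \<le> sin d \<longleftrightarrow> \<bar>x\<bar> \<le> d"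
proof -
  have s: "\<bar>sin x\<bar> = sin \<bar>x\<bar>" using assms(1) sin_ge_zero[of "\<bar>x\<bar>"] by (auto simp: abs_if)
  show ?thesis
  proof
    assume "\<bar>x\<bar> \<le> d"
    then show "\<bar>sin x\<bar> \<le> sin d" unfolding s using assms by (intro sin_monotone_2pi_le) auto
  next
    assume *: "\<bar>sin x\<bar> \<le> sin d"
    show "\<bar>x\<bar> \<le> d"
    proof (rule ccontr)
      assume "\<not> \<bar>x\<bar> \<le> d"
      show False
      proof (cases "\<bar>x\<bar> \<le> pi / 2")
        case True
        then have "sin d < sin \<bar>x\<bar>" using assms \<open>\<not> \<bar>x\<bar> \<le> d\<close> by (intro sin_monotone_2pi) auto
        then show False using * s by simp
      next
        case False
        then have "sin d < sin (pi - \<bar>x\<bar>)" using assms by (intro sin_monotone_2pi) auto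
        then show False using * s by simp
      qed
    qed
  qed
qed

lemma margin_score_le_iff:
  assumes "m > 0" "\<And>i. i < m \<Longrightarrow> p i \<in> {0<..pi/2}" "\<And>i. i < m \<Longrightarrow> q i \<in> {-pi/2..<0}"
    and "\<theta> \<in> {-pi/2..pi/2}" "0 \<le> d" "d < pi / 4"
  shows "margin_score m p q \<theta> \<le> 2 * sin d \<longleftrightarrow>
    \<bar>\<theta> - (Min (p ` {..<m}) + Max (q ` {..<m})) / 2\<bar> \<le> d"
proof -
  have "Min (p ` {..<m}) \<in> p ` {..<m}" "Max (q ` {..<m}) \<in> q ` {..<m}"
    using assms(1) by (intro Min_in Max_in; force)+
  then have "Min (p ` {..<m}) \<in> {0<..pi/2}" "Max (q ` {..<m}) \<in> {-pi/2..<0}"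
    using assms(2,3) by fastforce+
  then have "\<bar>\<theta> - (Min (p ` {..<m}) + Max (q ` {..<m})) / 2\<bar> \<le> 3 * pi / 4"
    using assms(4) unfolding abs_le_iff by (auto simp: field_simps)
  then show ?thesis
    using abs_sin_le_iff assms by (simp add: margin_score_def svm_train_set margin_normal_at)
qed

text \<open>A minimum is below a threshold iff one of its arguments is, so the sublevel set is the
  union of the intervals of radius \<open>d\<close> around all pairwise bisectors.\<close>

lemma min_margin_score_le_iff:
  assumes "\<beta> \<ge> 1 / real m" "m > 0"
    and "\<And>i. i < m \<Longrightarrow> p i \<in> {0<..pi/2}" "\<And>i. i < m \<Longrightarrow> q i \<in> {-pi/2..<0}"
    and "\<theta> \<in> {-pi/2..pi/2}" "0 \<le> d" "d < pi / 4"
  shows "min_margin_score m \<beta> p q \<theta> \<le> 2 * sin d \<longleftrightarrow>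
    (\<exists>i<m. \<exists>j<m. \<bar>\<theta> - (p i + q j) / 2\<bar> \<le> d)"
proof -
  have b: "\<bar>\<theta> - (p i + q j) / 2\<bar> \<le> 3 * pi / 4" if "i < m" "j < m" for i j
    using assms(3)[OF that(1)] assms(4)[OF that(2)] assms(5) unfolding abs_le_iff by (auto simp: field_simps)
  have bm: "boot_models m \<beta> p q = (\<lambda>(i, j). normal_at ((p i + q j) / 2)) ` ({..<m} \<times> {..<m})"
    using assms by (intro boot_models_eq) auto
  have "min_margin_score m \<beta> p q \<theta> \<le> 2 * sin d \<longleftrightarrow>
     (\<exists>i<m. \<exists>j<m. 2 * \<bar>sin (\<theta> - (p i + q j) / 2)\<bar> \<le> 2 * sin d)"
    unfolding min_margin_score_def bm image_image
    using assms(2) by (subst Min_le_iff) (auto simp: margin_normal_at)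
  also have "\<dots> \<longleftrightarrow> (\<exists>i<m. \<exists>j<m. \<bar>\<theta> - (p i + q j) / 2\<bar> \<le> d)"
    using abs_sin_le_iff[OF b assms(6,7)] by auto
  finally show ?thesis .
qed

section \<open>The selection rule and its deterministic consequences\<close>

lemma finite_select_lowest [simp]: "finite (select_lowest s n B)"
  by (rule finite_subset[of _ "{..<n}"]) (auto simp: select_lowest_def)

text \<open>The first index of minimal score has no predecessor. Nonemptiness matters because
  \<open>Theta_star\<close> is a \<open>Min\<close>, which is unspecified on the empty set.\<close>

lemma select_lowest_nonempty:
  assumes "n > 0" "B > 0"
  shows "select_lowest s n B \<noteq> {}"
proof -
  define t where "t = Min (s ` {..<n})"
  have "t \<in> s ` {..<n}" unfolding t_def using assms by (intro Min_in) auto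
  then have ex: "\<exists>i. i < n \<and> s i = t" by auto
  define i where "i = (LEAST i. i < n \<and> s i = t)"
  have i: "i < n" "s i = t" using LeastI_ex[OF ex] by (auto simp: i_def)
  have "t \<le> s j" if "j < n" for j using that by (auto simp: t_def)
  moreover have "\<not> (j < n \<and> s j = t)" if "j < i" for j
    using that unfolding i_def by (rule not_less_Least)
  ultimately have "{j. j < n \<and> (s j < s i \<or> (s j = s i \<and> j < i))} = {}"
    unfolding i(2) by (auto simp: not_less[symmetric])
  then have "card {j. j < n \<and> (s j < s i \<or> (s j = s i \<and> j < i))} < B"
    using assms by (metis card.empty)
  then have "i \<in> select_lowest s n B" using i(1) by (simp add: select_lowest_def)
  then show ?thesis by blast
qed

text \<open>All predecessors of \<open>k\<close> lie in the sublevel set, and \<open>k\<close>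
  itself lies there without preceding itself; this turns the bound \<open>\<le> B\<close> into the
  strict rank bound.\<close>

lemma select_lowestI:
  assumes "k < n" "s k \<le> t" "card {j. j < n \<and> s j \<le> t} \<le> B"
  shows "k \<in> select_lowest s n B"
proof -
  have "{j. j < n \<and> (s j < s k \<or> (s j = s k \<and> j < k))} \<subset> {j. j < n \<and> s j \<le> t}"
    using assms by auto
  then have "card {j. j < n \<and> (s j < s k \<or> (s j = s k \<and> j < k))} < card {j. j < n \<and> s j \<le> t}"
    by (intro psubset_card_mono) auto
  then show ?thesis using assms by (simp add: select_lowest_def)
qed

lemma select_lowestD:
  assumes "i \<in> select_lowest s n B" "B \<le> card {j. j < n \<and> s j \<le> t}"
  shows "s i \<le> t"
proof (rule ccontr)
  assume "\<not> s i \<le> t"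
  then have "card {j. j < n \<and> s j \<le> t} \<le> card {j. j < n \<and> (s j < s i \<or> (s j = s i \<and> j < i))}"
    by (intro card_mono) auto
  then show False using assms by (simp add: select_lowest_def)
qed

lemma Theta_star_le:
  assumes "k \<in> S" "finite S"
  shows "Theta_star z S \<le> (z k)\<^sup>2"
  unfolding Theta_star_def using assms by (intro Min_le) auto

text \<open>For any fixed pair, either a candidate close to its bisector is selected, or there is no
  such candidate, or at least \<open>B\<close> candidates compete for the batch. The last two cases
  will be improbable, so the trivial bound by the squared radius of the range suffices
  there.\<close>

lemma Theta_star_min_margin_cases:
  assumes "\<beta> \<ge> 1 / real m" "n > 0" "B > 0"
    and p: "\<And>i. i < m \<Longrightarrow> p i \<in> {0<..pi/2}" and q: "\<And>i. i < m \<Longrightarrow> q i \<in> {-pi/2..<0}"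
    and z: "\<And>k. k < n \<Longrightarrow> z k \<in> {-pi/2..pi/2}"
    and d: "0 \<le> d" "d < pi / 4" and ij: "i < m" "j < m"
  defines "\<Theta> \<equiv> Theta_star z (select_lowest (\<lambda>k. min_margin_score m \<beta> p q (z k)) n B)"
  obtains (near) "\<Theta> \<le> (\<bar>p i + q j\<bar> / 2 + d)\<^sup>2"
    | (missed) "\<Theta> \<le> (pi / 2)\<^sup>2" "\<And>k. k < n \<Longrightarrow> \<bar>z k - (p i + q j) / 2\<bar> > d"
    | (crowded) "\<Theta> \<le> (pi / 2)\<^sup>2" "B \<le> card {k. k < n \<and> (\<exists>i<m. \<exists>j<m. \<bar>z k - (p i + q j) / 2\<bar> \<le> d)}"
proof -
  define s where "s = (\<lambda>k. min_margin_score m \<beta> p q (z k))"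
  have s_iff: "s k \<le> 2 * sin d \<longleftrightarrow> (\<exists>i<m. \<exists>j<m. \<bar>z k - (p i + q j) / 2\<bar> \<le> d)" if "k < n" for k
    unfolding s_def using assms(1) ij p q z[OF that] d by (intro min_margin_score_le_iff) auto
  have sel_le: "\<Theta> \<le> (z k)\<^sup>2" if "k \<in> select_lowest s n B" for k
    unfolding \<Theta>_def s_def[symmetric] using that by (intro Theta_star_le) auto
  obtain k0 where k0: "k0 \<in> select_lowest s n B" using select_lowest_nonempty[OF assms(2,3)] by blast
  then have "k0 < n" by (simp add: select_lowest_def)
  then have "\<bar>z k0\<bar> \<le> pi / 2" using z[of k0] by (auto simp: abs_le_iff)
  then have "(z k0)\<^sup>2 \<le> (pi / 2)\<^sup>2" by (metis abs_le_square_iff abs_of_pos pi_half_gt_zero)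
  with sel_le[OF k0] have triv: "\<Theta> \<le> (pi / 2)\<^sup>2" by simp
  consider "\<forall>k<n. \<bar>z k - (p i + q j) / 2\<bar> > d"
    | k where "k < n" "\<bar>z k - (p i + q j) / 2\<bar> \<le> d" "card {j. j < n \<and> s j \<le> 2 * sin d} \<le> B"
    | "B \<le> card {j. j < n \<and> s j \<le> 2 * sin d}"
    by (meson not_less nle_le)
  then show ?thesis
  proof cases
    case 1
    then show ?thesis using missed triv by blast
  next
    case 2
    have "s k \<le> 2 * sin d" using 2 ij s_iff by blast
    then have "k \<in> select_lowest s n B" using 2 by (intro select_lowestI)
    then have "\<Theta> \<le> (z k)\<^sup>2" by (rule sel_le)
    also have "\<dots> \<le> (\<bar>p i + q j\<bar> / 2 + d)\<^sup>2"
    proof (subst abs_le_square_iff[symmetric])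
      have "\<bar>z k\<bar> \<le> \<bar>(p i + q j) / 2\<bar> + d" using 2(2) by arith
      then show "\<bar>z k\<bar> \<le> \<bar>\<bar>p i + q j\<bar> / 2 + d\<bar>" using d by simp
    qed
    finally show ?thesis by (rule near)
  next
    case 3
    have "{j. j < n \<and> s j \<le> 2 * sin d} = {k. k < n \<and> (\<exists>i<m. \<exists>j<m. \<bar>z k - (p i + q j) / 2\<bar> \<le> d)}"
      using s_iff by blast
    then show ?thesis using 3 triv crowded by metis
  qed
qed

text \<open>Once \<open>B\<close> candidates lie within \<open>w\<close> of the boundary angle, no
  candidate farther away can be selected, so every selected angle has absolute value at least the
  boundary's minus \<open>w\<close>.\<close>

lemma Theta_star_margin_ge:
  assumes "m > 0" "n > 0" "B > 0"
    and p: "\<And>i. i < m \<Longrightarrow> p i \<in> {0<..pi/2}" and q: "\<And>i. i < m \<Longrightarrow> q i \<in> {-pi/2..<0}"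
    and z: "\<And>k. k < n \<Longrightarrow> z k \<in> {-pi/2..pi/2}"
    and w: "0 \<le> w" "w < pi / 4"
  defines "\<phi> \<equiv> (Min (p ` {..<m}) + Max (q ` {..<m})) / 2"
  assumes crowd: "B \<le> card {k. k < n \<and> \<bar>z k - \<phi>\<bar> \<le> w}"
  shows "(max 0 (\<bar>\<phi>\<bar> - w))\<^sup>2 \<le> Theta_star z (select_lowest (\<lambda>k. margin_score m p q (z k)) n B)"
proof -
  define s where "s = (\<lambda>k. margin_score m p q (z k))"
  have s_iff: "s k \<le> 2 * sin w \<longleftrightarrow> \<bar>z k - \<phi>\<bar> \<le> w" if "k < n" for k
    unfolding s_def \<phi>_def using assms(1) p q z[OF that] w by (intro margin_score_le_iff) auto
  have "{k. k < n \<and> \<bar>z k - \<phi>\<bar> \<le> w} = {k. k < n \<and> s k \<le> 2 * sin w}" using s_iff by blast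
  with crowd have c: "B \<le> card {k. k < n \<and> s k \<le> 2 * sin w}" by simp
  have "(max 0 (\<bar>\<phi>\<bar> - w))\<^sup>2 \<le> (z k)\<^sup>2" if "k \<in> select_lowest s n B" for k
  proof -
    have "k < n" using that by (simp add: select_lowest_def)
    then have "\<bar>z k - \<phi>\<bar> \<le> w" using select_lowestD[OF that c] s_iff by blast
    then show ?thesis by (subst abs_le_square_iff[symmetric]) (auto simp: abs_if split: if_splits)
  qed
  then show ?thesis
    unfolding Theta_star_def s_def[symmetric] using select_lowest_nonempty[OF assms(2,3), of s]
    by (subst Min_ge_iff) auto
qed

subsection \<open>Second moments of minima\<close>

lemma nn_integral_prod_iid:
  assumes "prob_space N" "f \<in> borel_measurable N" "finite I"
  shows "(\<integral>\<^sup>+x. (\<Prod>i\<in>I. f (x i)) \<partial>PiM I (\<lambda>_. N)) = (\<integral>\<^sup>+x. f x \<partial>N) ^ card I"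
proof -
  interpret prob_space N by fact
  interpret product_sigma_finite "\<lambda>_. N" by unfold_locales
  show ?thesis using assms by (subst product_nn_integral_prod) auto
qed

lemma nn_integral_double_less:
  fixes u :: real
  assumes "u \<ge> 0"
  shows "(\<integral>\<^sup>+t. ennreal (2 * t) * (if 0 \<le> t \<and> t < u then 1 else 0) \<partial>lborel) = ennreal (u\<^sup>2)"
proof -
  have "(\<integral>\<^sup>+t. ennreal (2 * t) * (if 0 \<le> t \<and> t < u then 1 else 0) \<partial>lborel)
      = (\<integral>\<^sup>+t. ennreal (2 * t) * indicator {0..u} t \<partial>lborel)"
    \<comment> \<open>The half-open and closed intervals differ only at the null point
      \<open>u\<close>.\<close>
    by (intro nn_integral_cong_AE AE_mp[OF AE_lborel_singleton[of u] AE_I2])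
       (auto simp: indicator_def)
  also have "\<dots> = ennreal (u\<^sup>2 - 0\<^sup>2)"
    using assms by (intro nn_integral_FTC_Icc) (auto intro!: derivative_eq_intros)
  finally show ?thesis by simp
qed

lemma INF_image_attained:
  fixes f :: "'i \<Rightarrow> 'a::complete_linorder"
  assumes "finite I" "I \<noteq> {}"
  obtains i where "i \<in> I" "(INF i\<in>I. f i) = f i"
proof -
  have "(INF i\<in>I. f i) = Min (f ` I)" using assms by (simp add: Min_Inf)
  moreover have "Min (f ` I) \<in> f ` I" using assms by (intro Min_in) auto
  ultimately show ?thesis using that by auto
qed

text \<open>Layer-cake formula: \<open>u\<^sup>2\<close> is the integral of \<open>2 t\<close> over \<open>0 \<le> t < u\<close>,
  and a minimum exceeds \<open>t\<close> iff all of its arguments do.\<close>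
lemma nn_integral_INF_square:
  fixes f :: "real \<Rightarrow> real"
  assumes "prob_space N" and sets[measurable_cong]: "sets N = sets borel"
    and f[measurable]: "f \<in> borel_measurable borel" and nonneg: "\<And>x. f x \<ge> 0"
    and I: "finite I" "I \<noteq> {}"
  shows "(\<integral>\<^sup>+x. (INF i\<in>I. ennreal ((f (x i))\<^sup>2)) \<partial>PiM I (\<lambda>_. N))
    = (\<integral>\<^sup>+t. ennreal (2 * t) * indicator {0..} t * emeasure N {x. t < f x} ^ card I \<partial>lborel)"
proof -
  interpret prob_space N by fact
  interpret product_prob_space "\<lambda>_. N" I by unfold_locales
  interpret pair_sigma_finite "PiM I (\<lambda>_. N)" lborel by unfold_locales
  have ind_meas: "(\<lambda>x. if t < f x then 1 else 0 :: ennreal) \<in> borel_measurable N" for t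
    by measurable
  have [measurable]: "(\<lambda>x. x i) \<in> borel_measurable (PiM I (\<lambda>_. N))" if "i \<in> I" for i
    using measurable_component_singleton[OF that, of "\<lambda>_. N"] measurable_cong_sets[OF refl sets] by blast
  have layer: "(INF i\<in>I. ennreal ((f (x i))\<^sup>2)) =
    (\<integral>\<^sup>+t. ennreal (2 * t) * indicator {0..} t * (\<Prod>i\<in>I. if t < f (x i) then 1 else 0) \<partial>lborel)" for x
  proof -
    obtain i where i: "i \<in> I" "(INF i\<in>I. ennreal ((f (x i))\<^sup>2)) = ennreal ((f (x i))\<^sup>2)"
      by (rule INF_image_attained[OF I, of "\<lambda>i. ennreal ((f (x i))\<^sup>2)"])
    have le: "f (x i) \<le> f (x j)" if "j \<in> I" for j
    proof -
      have "ennreal ((f (x i))\<^sup>2) \<le> ennreal ((f (x j))\<^sup>2)"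
        using INF_lower[OF that, of "\<lambda>i. ennreal ((f (x i))\<^sup>2)"] i(2) by simp
      then have "(f (x i))\<^sup>2 \<le> (f (x j))\<^sup>2" by (simp add: ennreal_le_iff)
      then show ?thesis using nonneg by (rule power2_le_imp_le)
    qed
    \<comment> \<open>With \<open>i\<close> a minimising index, all factors are one exactly when the
      \<open>i\<close>-th is.\<close>
    have "(\<Prod>i\<in>I. if t < f (x i) then 1 else 0) = (if t < f (x i) then 1 else (0::ennreal))" for t
    proof (cases "t < f (x i)")
      case True
      then have "\<forall>j\<in>I. t < f (x j)" using le by (meson less_le_trans)
      then show ?thesis using True by simp
    next
      case False
      then show ?thesis using i(1) I by (auto simp: prod_zero_iff)
    qed
    then have "ennreal (2 * t) * indicator {0..} t * (\<Prod>i\<in>I. if t < f (x i) then 1 else 0)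
       = ennreal (2 * t) * (if 0 \<le> t \<and> t < f (x i) then 1 else 0)" for t
      by (auto simp: indicator_def)
    then show ?thesis using i(2) nn_integral_double_less[OF nonneg[of "x i"]] by simp
  qed
  have meas: "(\<lambda>(x, t). ennreal (2 * t) * indicator {0..} t * (\<Prod>i\<in>I. if t < f (x i) then 1 else 0))
      \<in> borel_measurable (PiM I (\<lambda>_. N) \<Otimes>\<^sub>M lborel)"
    by measurable
  have "(\<integral>\<^sup>+x. (INF i\<in>I. ennreal ((f (x i))\<^sup>2)) \<partial>PiM I (\<lambda>_. N)) =
    (\<integral>\<^sup>+t. (\<integral>\<^sup>+x. ennreal (2 * t) * indicator {0..} t * (\<Prod>i\<in>I. if t < f (x i) then 1 else 0)
       \<partial>PiM I (\<lambda>_. N)) \<partial>lborel)"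
    unfolding layer by (rule Fubini'[OF meas, symmetric])
  also have "\<dots> = (\<integral>\<^sup>+t. ennreal (2 * t) * indicator {0..} t * emeasure N {x. t < f x} ^ card I \<partial>lborel)"
  proof (rule nn_integral_cong)
    fix t :: real
    have "(\<integral>\<^sup>+x. ennreal (2 * t) * indicator {0..} t * (\<Prod>i\<in>I. if t < f (x i) then 1 else 0)
       \<partial>PiM I (\<lambda>_. N)) = ennreal (2 * t) * indicator {0..} t *
         (\<integral>\<^sup>+x. (\<Prod>i\<in>I. if t < f (x i) then 1 else 0) \<partial>PiM I (\<lambda>_. N))"
      by (rule nn_integral_cmult) measurable
    also have "(\<integral>\<^sup>+x. (\<Prod>i\<in>I. if t < f (x i) then 1 else 0) \<partial>PiM I (\<lambda>_. N))
       = (\<integral>\<^sup>+x. (if t < f x then 1 else 0) \<partial>N) ^ card I"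
      by (rule nn_integral_prod_iid[OF \<open>prob_space N\<close> ind_meas I(1)])
    also have "(\<integral>\<^sup>+x. (if t < f x then 1 else 0) \<partial>N) = emeasure N {x. t < f x}"
    proof -
      have "(\<integral>\<^sup>+x. (if t < f x then 1 else 0) \<partial>N) = (\<integral>\<^sup>+x. indicator {x. t < f x} x \<partial>N)"
        by (intro nn_integral_cong) (auto simp: indicator_def)
      then show ?thesis by (simp add: sets)
    qed
    finally show "(\<integral>\<^sup>+x. ennreal (2 * t) * indicator {0..} t * (\<Prod>i\<in>I. if t < f (x i) then 1 else 0)
       \<partial>PiM I (\<lambda>_. N)) = ennreal (2 * t) * indicator {0..} t * emeasure N {x. t < f x} ^ card I" .
  qed
  finally show ?thesis .
qed

text \<open>The Beta integral \<open>B(2, m + 1)\<close>, rescaled to the interval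
  \<open>[0, c]\<close>; it evaluates the layer-cake formula for a linear tail.\<close>

lemma nn_integral_beta_moment:
  fixes c h :: real
  assumes "c \<ge> 0" "h > 0"
  shows "(\<integral>\<^sup>+t. ennreal (2 * t * ((c - t) / h) ^ m) * indicator {0..c} t \<partial>lborel)
    = ennreal (2 * c ^ (m + 2) / (h ^ m * ((real m + 1) * (real m + 2))))"
proof -
  define a b where "a = 2 / (h ^ m * (real m + 1))" and "b = 2 / (h ^ m * ((real m + 1) * (real m + 2)))"
  \<comment> \<open>An antiderivative found by parts: since \<open>b * (m + 2) = a\<close>, the
    second term cancels the unwanted summand in the derivative of the first. It vanishes at
    \<open>c\<close>, so only \<open>- F 0\<close> remains.\<close>
  define F where "F = (\<lambda>t. - (a * (t * (c - t) ^ (m + 1))) - b * (c - t) ^ (m + 2))"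
  have "(\<integral>\<^sup>+t. ennreal (2 * t * ((c - t) / h) ^ m) * indicator {0..c} t \<partial>lborel) = ennreal (F c - F 0)"
  proof (intro nn_integral_FTC_Icc)
    fix t assume "t \<in> {0..c}"
    then show "0 \<le> 2 * t * ((c - t) / h) ^ m" using assms by simp
    have pow: "((\<lambda>t. (c - t) ^ Suc k) has_real_derivative - ((real k + 1) * (c - t) ^ k)) (at t)" for k
      by (rule DERIV_cong[OF DERIV_power_Suc[where D = "-1"]]) (auto intro!: derivative_eq_intros)
    have "((\<lambda>t. (c - t) ^ (m + 1)) has_real_derivative - ((real m + 1) * (c - t) ^ m)) (at t)"
      using pow[of m] by simp
    moreover have "((\<lambda>t. (c - t) ^ (m + 2)) has_real_derivative - ((real m + 2) * (c - t) ^ (m + 1))) (at t)"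
      using pow[of "m + 1"] by (simp add: add.commute)
    ultimately have "(F has_real_derivative
        - (a * (1 * (c - t) ^ (m + 1) + - ((real m + 1) * (c - t) ^ m) * t))
        - b * - ((real m + 2) * (c - t) ^ (m + 1))) (at t)"
      unfolding F_def by (intro DERIV_diff DERIV_minus DERIV_cmult DERIV_mult DERIV_ident)
    also have "- (a * (1 * (c - t) ^ (m + 1) + - ((real m + 1) * (c - t) ^ m) * t))
        - b * - ((real m + 2) * (c - t) ^ (m + 1)) = 2 * t * ((c - t) / h) ^ m"
    proof -
      have "b * (real m + 2) = a" "a * (real m + 1) = 2 / h ^ m"
        using assms by (simp_all add: a_def b_def divide_simps)
      then have "b * ((real m + 2) * (c - t) ^ (m + 1)) = a * (c - t) ^ (m + 1)"
        "a * ((real m + 1) * (c - t) ^ m * t) = 2 / h ^ m * (c - t) ^ m * t"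
        by (simp_all only: mult.assoc[symmetric])
      then show ?thesis by (simp add: power_divide algebra_simps)
    qed
    finally show "(F has_real_derivative 2 * t * ((c - t) / h) ^ m) (at t)" .
  qed (use assms in auto)
  also have "F c - F 0 = 2 * c ^ (m + 2) / (h ^ m * ((real m + 1) * (real m + 2)))"
    by (simp add: F_def b_def)
  finally show ?thesis .
qed

section \<open>Uniform laws on intervals\<close>

lemma emeasure_uniform_le:
  assumes "A \<in> sets borel" "emeasure lborel A = ennreal h" "h > 0"
    and "X \<in> sets borel" "Y \<in> sets borel" "A \<inter> X \<subseteq> Y" "emeasure lborel Y \<le> ennreal c" "c \<ge> 0"
  shows "emeasure (uniform_measure lborel A) X \<le> ennreal (c / h)"
proof -
  have "emeasure lborel (A \<inter> X) \<le> emeasure lborel Y" using assms by (intro emeasure_mono) auto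
  then have "emeasure lborel (A \<inter> X) / ennreal h \<le> ennreal c / ennreal h"
    using assms(7) by (intro divide_right_mono_ennreal) auto
  then show ?thesis using assms by (simp add: divide_ennreal)
qed

lemma emeasure_uniform_ge:
  assumes "A \<in> sets borel" "emeasure lborel A = ennreal h" "h > 0"
    and "X \<in> sets borel" "Y \<subseteq> A \<inter> X" "ennreal c \<le> emeasure lborel Y" "c \<ge> 0"
  shows "ennreal (c / h) \<le> emeasure (uniform_measure lborel A) X"
proof -
  have "emeasure lborel Y \<le> emeasure lborel (A \<inter> X)" using assms by (intro emeasure_mono) auto
  then have "ennreal c / ennreal h \<le> emeasure lborel (A \<inter> X) / ennreal h"
    using assms(6) by (intro divide_right_mono_ennreal) auto
  then show ?thesis using assms by (simp add: divide_ennreal)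
qed

lemma prob_space_uniform:
  assumes "A \<in> sets borel" "emeasure lborel A = ennreal h" "h > 0"
  shows "prob_space (uniform_measure lborel A)"
  using assms by (intro prob_space_uniform_measure) auto

lemma prob_space_positive: "prob_space (uniform_measure lborel {0<..pi/2})"
  by (rule prob_space_uniform[where h = "pi/2"]) auto

lemma prob_space_negative: "prob_space (uniform_measure lborel {-pi/2..<0})"
  by (rule prob_space_uniform[where h = "pi/2"]) auto

lemma prob_space_candidate: "prob_space (uniform_measure lborel {-pi/2..pi/2})"
  by (rule prob_space_uniform[where h = pi]) auto

text \<open>In the layer-cake integral the tail is replaced by its linear minorant on
  \<open>[0, c]\<close> and by zero beyond, which leaves a Beta integral.\<close>

lemma nn_integral_INF_square_ge:
  fixes f :: "real \<Rightarrow> real"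
  assumes "prob_space N" "sets N = sets borel" "f \<in> borel_measurable borel" "\<And>x. f x \<ge> 0"
    and "m > 0" "c \<ge> 0" "h > 0"
    and tail: "\<And>t. 0 \<le> t \<Longrightarrow> t \<le> c \<Longrightarrow> ennreal ((c - t) / h) \<le> emeasure N {x. t < f x}"
  shows "ennreal (2 * c ^ (m + 2) / (h ^ m * ((real m + 1) * (real m + 2))))
    \<le> (\<integral>\<^sup>+x. (INF i\<in>{..<m}. ennreal ((f (x i))\<^sup>2)) \<partial>PiM {..<m} (\<lambda>_. N))"
proof -
  have "(\<integral>\<^sup>+t. ennreal (2 * t * ((c - t) / h) ^ m) * indicator {0..c} t \<partial>lborel) \<le>
    (\<integral>\<^sup>+t. ennreal (2 * t) * indicator {0..} t * emeasure N {x. t < f x} ^ m \<partial>lborel)"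
  proof (rule nn_integral_mono)
    fix t :: real
    show "ennreal (2 * t * ((c - t) / h) ^ m) * indicator {0..c} t
      \<le> ennreal (2 * t) * indicator {0..} t * emeasure N {x. t < f x} ^ m"
    proof (cases "t \<in> {0..c}")
      case True
      then have "ennreal (((c - t) / h) ^ m) \<le> emeasure N {x. t < f x} ^ m"
        using tail[of t] assms by (subst ennreal_power[symmetric]) (auto intro!: power_mono)
      then have "ennreal (2 * t) * ennreal (((c - t) / h) ^ m) \<le> ennreal (2 * t) * emeasure N {x. t < f x} ^ m"
        by (intro mult_left_mono) auto
      then show ?thesis using True assms by (simp add: ennreal_mult)
    qed auto
  qed
  also have "\<dots> = (\<integral>\<^sup>+x. (INF i\<in>{..<m}. ennreal ((f (x i))\<^sup>2)) \<partial>PiM {..<m} (\<lambda>_. N))"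
    using assms by (subst nn_integral_INF_square) (auto simp: lessThan_empty_iff)
  finally show ?thesis using nn_integral_beta_moment[of c h m] assms by simp
qed

text \<open>At \<open>y = 0\<close> this is the second moment of the minimum of \<open>m\<close>
  uniform angles, \<open>2 / ((m + 1) (m + 2))\<close> on the unit scale. The shift \<open>y\<close>
  will absorb the opposite class's angle and the width of the batch.\<close>

lemma expected_min_positive_ge:
  assumes "0 \<le> y" "y \<le> pi / 2" "m > 0"
  shows "ennreal (2 * (pi / 2 - y) ^ (m + 2) / ((pi / 2) ^ m * ((real m + 1) * (real m + 2))))
    \<le> (\<integral>\<^sup>+p. (INF i\<in>{..<m}. ennreal ((max 0 (p i - y))\<^sup>2)) \<partial>PiM {..<m} (\<lambda>_. uniform_measure lborel {0<..pi/2}))"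
proof (rule nn_integral_INF_square_ge)
  show "ennreal ((pi / 2 - y - t) / (pi / 2)) \<le> emeasure (uniform_measure lborel {0<..pi / 2}) {x. t < max 0 (x - y)}"
    if "0 \<le> t" "t \<le> pi / 2 - y" for t
    by (rule emeasure_uniform_ge[where Y = "{y + t<..pi/2}"]) (use that assms in auto)
qed (use assms in \<open>auto intro!: prob_space_uniform\<close>)

lemma expected_min_negative_ge:
  assumes "0 \<le> y" "y \<le> pi / 2" "m > 0"
  shows "ennreal (2 * (pi / 2 - y) ^ (m + 2) / ((pi / 2) ^ m * ((real m + 1) * (real m + 2))))
    \<le> (\<integral>\<^sup>+q. (INF i\<in>{..<m}. ennreal ((max 0 (- q i - y))\<^sup>2)) \<partial>PiM {..<m} (\<lambda>_. uniform_measure lborel {-pi/2..<0}))"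
proof (rule nn_integral_INF_square_ge)
  show "ennreal ((pi / 2 - y - t) / (pi / 2)) \<le> emeasure (uniform_measure lborel {-pi/2..<0}) {x. t < max 0 (- x - y)}"
    if "0 \<le> t" "t \<le> pi / 2 - y" for t
    by (rule emeasure_uniform_ge[where Y = "{-pi/2..<-y-t}"]) (use that assms in auto)
qed (use assms in \<open>auto intro!: prob_space_uniform\<close>)

text \<open>A point in the middle half has room on both sides, so its nearest neighbour is on average half
  as far away as that of an endpoint; without this factor the final comparison would fail.\<close>
lemma expected_nearest_le:
  assumes a: "a \<in> {pi/8..3*pi/8}" and "m > 0"
  shows "(\<integral>\<^sup>+q. (INF j\<in>{..<m}. ennreal ((a + q j)\<^sup>2)) \<partial>PiM {..<m} (\<lambda>_. uniform_measure lborel {-pi/2..<0}))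
    \<le> ennreal ((pi/2)\<^sup>2 * (1 / (2 * ((real m + 1) * (real m + 2))) + (1/2) ^ m))"
proof -
  let ?N = "uniform_measure lborel {-pi/2..<0}"
  \<comment> \<open>The reflected point \<open>- a\<close> is at least \<open>pi/8\<close> from both
    ends of the interval. Up to this distance its neighbourhood is two-sided and removes length
    \<open>2 * t\<close>.\<close>
  have tail1: "emeasure ?N {x. t < \<bar>a + x\<bar>} \<le> ennreal ((pi/2 - 2*t) / (pi/2))" if "0 \<le> t" "t \<le> pi/8" for t
  proof (rule emeasure_uniform_le[where Y = "{-pi/2..-a-t} \<union> {t-a..0}"])
    have "emeasure lborel ({-pi/2..-a-t} \<union> {t-a..0}) \<le> emeasure lborel {-pi/2..-a-t} + emeasure lborel {t-a..0}"
      by (intro emeasure_subadditive) auto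
    also have "\<dots> = ennreal (pi/2 - 2*t)"
      using a that by (simp add: ennreal_plus[symmetric] del: ennreal_plus)
    finally show "emeasure lborel ({-pi/2..-a-t} \<union> {t-a..0}) \<le> ennreal (pi/2 - 2*t)" .
  qed (use a that in auto)
  have tail2: "emeasure ?N {x. t < \<bar>a + x\<bar>} \<le> ennreal (1/2)" if "pi/8 \<le> t" for t
  proof -
    have "emeasure ?N {x. t < \<bar>a + x\<bar>} \<le> emeasure ?N {x. pi/8 < \<bar>a + x\<bar>}"
      using that by (intro emeasure_mono) auto
    also have "\<dots> \<le> ennreal (1/2)" using tail1[of "pi/8"] by simp
    finally show ?thesis .
  qed
  have tail3: "emeasure ?N {x. t < \<bar>a + x\<bar>} = 0" if "pi/2 \<le> t" for t
  proof -
    have "emeasure ?N {x. t < \<bar>a + x\<bar>} \<le> ennreal (0 / (pi/2))"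
      by (rule emeasure_uniform_le[where Y = "{}"]) (use a that in auto)
    then show ?thesis by simp
  qed
  have beta: "(\<integral>\<^sup>+t. ennreal (2 * t * ((pi/4 - t) / (pi/4)) ^ m) * indicator {0..pi/4} t \<partial>lborel)
    = ennreal (2 * (pi/4) ^ (m + 2) / ((pi/4) ^ m * ((real m + 1) * (real m + 2))))"
    by (rule nn_integral_beta_moment) auto
  have square: "(\<integral>\<^sup>+t. ennreal (2 * t) * (if 0 \<le> t \<and> t < pi/2 then 1 else 0) \<partial>lborel) = ennreal ((pi/2)\<^sup>2)"
    by (rule nn_integral_double_less) auto
  have ne: "{..<m} \<noteq> {}" using assms(2) by (auto simp: lessThan_empty_iff)
  have "(\<integral>\<^sup>+q. (INF j\<in>{..<m}. ennreal (\<bar>a + q j\<bar>\<^sup>2)) \<partial>PiM {..<m} (\<lambda>_. ?N)) =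
    (\<integral>\<^sup>+t. ennreal (2 * t) * indicator {0..} t * emeasure ?N {x. t < \<bar>a + x\<bar>} ^ card {..<m} \<partial>lborel)"
    by (rule nn_integral_INF_square[OF prob_space_negative _ _ _ finite_lessThan ne]) auto
  then have "(\<integral>\<^sup>+q. (INF j\<in>{..<m}. ennreal ((a + q j)\<^sup>2)) \<partial>PiM {..<m} (\<lambda>_. ?N)) =
    (\<integral>\<^sup>+t. ennreal (2 * t) * indicator {0..} t * emeasure ?N {x. t < \<bar>a + x\<bar>} ^ m \<partial>lborel)"
    unfolding power2_abs card_lessThan .
  \<comment> \<open>The two-sided tail gives a Beta integral of scale \<open>pi/4\<close>, half of
    that of a one-sided tail. From \<open>pi/8\<close> on, the tail is at most \<open>1/2\<close>,
    leaving an exponentially small remainder.\<close>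
  also have "\<dots> \<le> (\<integral>\<^sup>+t. ennreal (2 * t * ((pi/4 - t) / (pi/4)) ^ m) * indicator {0..pi/4} t
      + ennreal ((1/2) ^ m) * (ennreal (2 * t) * (if 0 \<le> t \<and> t < pi/2 then 1 else 0)) \<partial>lborel)"
  proof (rule nn_integral_mono)
    fix t :: real
    let ?E = "emeasure ?N {x. t < \<bar>a + x\<bar>}"
    consider "t < 0" | "0 \<le> t" "t \<le> pi/8" | "pi/8 \<le> t" "t < pi/2" | "pi/2 \<le> t" by linarith
    then show "ennreal (2 * t) * indicator {0..} t * ?E ^ m \<le>
      ennreal (2 * t * ((pi/4 - t) / (pi/4)) ^ m) * indicator {0..pi/4} t
      + ennreal ((1/2) ^ m) * (ennreal (2 * t) * (if 0 \<le> t \<and> t < pi/2 then 1 else 0))"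
    proof cases
      case 2
      have "?E ^ m \<le> ennreal ((pi/2 - 2*t) / (pi/2)) ^ m" using tail1[OF 2] by (intro power_mono) auto
      also have "(pi/2 - 2*t) / (pi/2) = (pi/4 - t) / (pi/4)" by (simp add: field_simps)
      finally have "?E ^ m \<le> ennreal (((pi/4 - t) / (pi/4)) ^ m)" using 2 by (simp add: ennreal_power)
      then have "ennreal (2 * t) * ?E ^ m \<le> ennreal (2 * t) * ennreal (((pi/4 - t) / (pi/4)) ^ m)"
        by (intro mult_left_mono) auto
      also have "\<dots> = ennreal (2 * t * ((pi/4 - t) / (pi/4)) ^ m)" using 2 by (simp add: ennreal_mult)
      finally have "ennreal (2 * t) * ?E ^ m \<le> ennreal (2 * t * ((pi/4 - t) / (pi/4)) ^ m)" .
      moreover have ind: "indicator {0..} t = (1::ennreal)" "indicator {0..pi/4} t = (1::ennreal)"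
        using 2 by (auto simp: indicator_def)
      ultimately show ?thesis unfolding ind mult_1_right by (intro add_increasing2 zero_le)
    next
      case 3
      have "?E ^ m \<le> ennreal (1/2) ^ m" using tail2[OF 3(1)] by (intro power_mono) auto
      then have "?E ^ m \<le> ennreal ((1/2) ^ m)" by (simp only: ennreal_power)
      then have *: "ennreal (2 * t) * ?E ^ m \<le> ennreal (2 * t) * ennreal ((1/2) ^ m)"
        by (intro mult_left_mono) auto
      have "0 \<le> t" using 3(1) pi_gt_zero by linarith
      then have ind: "indicator {0..} t = (1::ennreal)" "(if 0 \<le> t \<and> t < pi/2 then 1 else 0) = (1::ennreal)"
        using 3 by (auto simp: indicator_def)
      show ?thesis unfolding ind mult_1_right
        by (rule add_increasing[OF zero_le]) (use * in \<open>simp only: mult.commute\<close>)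
    qed (use tail3[of t] \<open>m > 0\<close> in \<open>auto simp: zero_power\<close>)
  qed
  also have "\<dots> = ennreal (2 * (pi/4) ^ (m + 2) / ((pi/4) ^ m * ((real m + 1) * (real m + 2))))
      + ennreal ((1/2) ^ m) * ennreal ((pi/2)\<^sup>2)"
    unfolding beta[symmetric]
      square[symmetric]
    by (subst nn_integral_add, simp, simp, subst nn_integral_cmult, simp, rule refl)
  also have "\<dots> = ennreal (2 * (pi/4) ^ (m + 2) / ((pi/4) ^ m * ((real m + 1) * (real m + 2)))
      + (1/2) ^ m * (pi/2)\<^sup>2)"
    by (subst ennreal_plus) (auto simp: ennreal_mult)
  also have "2 * (pi/4) ^ (m + 2) / ((pi/4) ^ m * ((real m + 1) * (real m + 2)))
     = (pi/2)\<^sup>2 * (1 / (2 * ((real m + 1) * (real m + 2))))"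
  proof -
    have "2 * (pi/4) ^ (m + 2) / ((pi/4) ^ m * X) = (pi/2)\<^sup>2 * (1 / (2 * X))" if "X > 0" for X :: real
      using that by (simp add: power_add field_simps power2_eq_square)
    then show ?thesis by simp
  qed
  finally show ?thesis by (simp add: algebra_simps)
qed

subsection \<open>Candidates near a direction\<close>

abbreviation "positive_sample m \<equiv> PiM {..<m::nat} (\<lambda>_. uniform_measure lborel {0<..pi/2})"
abbreviation "negative_sample m \<equiv> PiM {..<m::nat} (\<lambda>_. uniform_measure lborel {-pi/2..<0})"
abbreviation "candidates n \<equiv> PiM {..<n::nat} (\<lambda>_. uniform_measure lborel {-pi/2..pi/2})"

lemma prob_space_candidates: "prob_space (candidates n)"
  by (intro prob_space_PiM prob_space_candidate)

lemma power_one_minus_le_exp: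
  fixes x :: real
  assumes "x \<le> 1"
  shows "(1 - x) ^ n \<le> exp (- x * real n)"
proof -
  have "(1 - x) ^ n \<le> exp (- x) ^ n" using assms exp_ge_add_one_self[of "-x"] by (intro power_mono) auto
  then show ?thesis by (simp add: exp_of_nat_mult[symmetric] mult.commute)
qed

lemma power_one_plus_le_exp:
  fixes x :: real
  assumes "x \<ge> 0"
  shows "(1 + x) ^ n \<le> exp (x * real n)"
  using power_one_minus_le_exp[of "- x" n] assms by simp

lemma emeasure_candidate_near_le:
  assumes "d \<ge> 0"
  shows "emeasure (uniform_measure lborel {-pi/2..pi/2}) {x. \<bar>x - c\<bar> \<le> d} \<le> ennreal (2 * d / pi)"
  by (rule emeasure_uniform_le[where Y = "{c-d..c+d}"]) (use assms in auto)

lemma emeasure_candidate_far_le: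
  assumes "0 \<le> d" "\<bar>c\<bar> + d \<le> pi/2"
  shows "emeasure (uniform_measure lborel {-pi/2..pi/2}) {x. d < \<bar>x - c\<bar>} \<le> ennreal (1 - 2 * d / pi)"
proof -
  have "emeasure (uniform_measure lborel {-pi/2..pi/2}) {x. d < \<bar>x - c\<bar>} \<le> ennreal ((pi - 2 * d) / pi)"
  proof (rule emeasure_uniform_le[where Y = "{-pi/2..c-d} \<union> {c+d..pi/2}"])
    have "emeasure lborel ({-pi/2..c-d} \<union> {c+d..pi/2}) \<le> emeasure lborel {-pi/2..c-d} + emeasure lborel {c+d..pi/2}"
      by (intro emeasure_subadditive) auto
    also have "\<dots> = ennreal (pi - 2*d)"
      using assms by (simp add: ennreal_plus[symmetric] del: ennreal_plus)
    finally show "emeasure lborel ({-pi/2..c-d} \<union> {c+d..pi/2}) \<le> ennreal (pi - 2 * d)" .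
  qed (use assms in auto)
  then show ?thesis by (simp add: diff_divide_distrib)
qed

text \<open>The product is the indicator that every candidate misses the neighbourhood; independence
  gives an \<open>n\<close>-th power. The range condition keeps the neighbourhood inside the
  candidates' interval, so its full length counts.\<close>

lemma expected_missed_le:
  assumes "0 \<le> d" "\<bar>c\<bar> + d \<le> pi/2"
  shows "(\<integral>\<^sup>+z. (\<Prod>k<n. if d < \<bar>z k - c\<bar> then 1 else 0) \<partial>candidates n) \<le> ennreal (exp (- (2 * d / pi) * real n))"
proof -
  let ?N = "uniform_measure lborel {-pi/2..pi/2}"
  have "(\<integral>\<^sup>+x. (if d < \<bar>x - c\<bar> then 1 else 0) \<partial>?N) = (\<integral>\<^sup>+x. indicator {x. d < \<bar>x - c\<bar>} x \<partial>?N)"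
    by (intro nn_integral_cong) (auto simp: indicator_def)
  also have "\<dots> \<le> ennreal (1 - 2 * d / pi)"
    using emeasure_candidate_far_le[OF assms] by (subst nn_integral_indicator) auto
  finally have le: "(\<integral>\<^sup>+x. (if d < \<bar>x - c\<bar> then 1 else 0) \<partial>?N) \<le> ennreal (1 - 2 * d / pi)" .
  have d1: "2 * d / pi \<le> 1" using assms by (simp add: field_simps)
  have "(\<integral>\<^sup>+z. (\<Prod>k<n. if d < \<bar>z k - c\<bar> then 1 else 0) \<partial>candidates n) =
    (\<integral>\<^sup>+x. (if d < \<bar>x - c\<bar> then 1 else 0) \<partial>?N) ^ n"
    by (subst nn_integral_prod_iid[OF prob_space_candidate]) auto
  also have "\<dots> \<le> ennreal (1 - 2 * d / pi) ^ n" using le by (intro power_mono) auto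
  also have "\<dots> = ennreal ((1 - 2 * d / pi) ^ n)" using d1 by (simp add: ennreal_power)
  also have "\<dots> \<le> ennreal (exp (- (2 * d / pi) * real n))"
    using power_one_minus_le_exp[OF d1] by (intro ennreal_leI) simp
  finally show ?thesis .
qed

text \<open>An exponential-moment bound for the number of candidates near any of several directions.
  Each factor counts the nearby directions with multiplicity, so overlapping neighbourhoods are
  merely overcounted and its mean follows from linearity.\<close>

lemma expected_crowded_le:
  fixes c :: "'i \<Rightarrow> real"
  assumes "0 \<le> d" "0 \<le> l" "finite F"
  shows "(\<integral>\<^sup>+z. (\<Prod>k<n. 1 + ennreal l * (\<Sum>i\<in>F. if \<bar>z k - c i\<bar> \<le> d then 1 else 0)) \<partial>candidates n)
    \<le> ennreal (exp (l * (real (card F) * (2 * d / pi)) * real n))"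
proof -
  let ?N = "uniform_measure lborel {-pi/2..pi/2}"
  interpret N: prob_space ?N by (rule prob_space_candidate)
  have "(\<integral>\<^sup>+x. 1 + ennreal l * (\<Sum>i\<in>F. if \<bar>x - c i\<bar> \<le> d then 1 else 0) \<partial>?N)
    = 1 + ennreal l * (\<Sum>i\<in>F. \<integral>\<^sup>+x. (if \<bar>x - c i\<bar> \<le> d then 1 else 0) \<partial>?N)"
    using assms N.emeasure_space_1 by (simp add: nn_integral_add nn_integral_cmult nn_integral_sum)
  also have "\<dots> \<le> 1 + ennreal l * (\<Sum>i\<in>F. ennreal (2 * d / pi))"
  proof (intro add_left_mono mult_left_mono sum_mono)
    fix i
    have "(\<integral>\<^sup>+x. (if \<bar>x - c i\<bar> \<le> d then 1 else 0) \<partial>?N) = (\<integral>\<^sup>+x. indicator {x. \<bar>x - c i\<bar> \<le> d} x \<partial>?N)"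
      by (intro nn_integral_cong) (auto simp: indicator_def)
    also have "\<dots> \<le> ennreal (2 * d / pi)"
      using emeasure_candidate_near_le[OF assms(1)] by (subst nn_integral_indicator) auto
    finally show "(\<integral>\<^sup>+x. (if \<bar>x - c i\<bar> \<le> d then 1 else 0) \<partial>?N) \<le> ennreal (2 * d / pi)" .
  qed simp
  also have "\<dots> = ennreal (1 + l * (real (card F) * (2 * d / pi)))"
  proof -
    have "(\<Sum>i\<in>F. ennreal (2 * d / pi)) = ennreal (real (card F) * (2 * d / pi))"
      using assms by (subst sum_ennreal) auto
    moreover have "1 + ennreal l * ennreal x = ennreal (1 + l * x)" if "x \<ge> 0" for x
      using assms that by (simp add: ennreal_mult)
    ultimately show ?thesis using assms by simp
  qed
  finally have le: "(\<integral>\<^sup>+x. 1 + ennreal l * (\<Sum>i\<in>F. if \<bar>x - c i\<bar> \<le> d then 1 else 0) \<partial>?N)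
     \<le> ennreal (1 + l * (real (card F) * (2 * d / pi)))" .
  have "(\<integral>\<^sup>+z. (\<Prod>k<n. 1 + ennreal l * (\<Sum>i\<in>F. if \<bar>z k - c i\<bar> \<le> d then 1 else 0)) \<partial>candidates n)
    = (\<integral>\<^sup>+x. 1 + ennreal l * (\<Sum>i\<in>F. if \<bar>x - c i\<bar> \<le> d then 1 else 0) \<partial>?N) ^ n"
    by (subst nn_integral_prod_iid[OF prob_space_candidate]) auto
  also have "\<dots> \<le> ennreal (1 + l * (real (card F) * (2 * d / pi))) ^ n"
    using le by (intro power_mono) auto
  also have "\<dots> = ennreal ((1 + l * (real (card F) * (2 * d / pi))) ^ n)"
    using assms by (intro ennreal_power) auto
  also have "\<dots> \<le> ennreal (exp (l * (real (card F) * (2 * d / pi)) * real n))"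
    using assms by (intro ennreal_leI power_one_plus_le_exp) auto
  finally show ?thesis .
qed

text \<open>The pointwise half of Markov's inequality: dividing by \<open>a ^ B\<close>, the product
  dominates the indicator that at least \<open>B\<close> indices satisfy \<open>P\<close>.\<close>

lemma power_card_le_prod:
  fixes g :: "nat \<Rightarrow> ennreal"
  assumes "\<And>k. k < n \<Longrightarrow> 1 \<le> g k" "\<And>k. k < n \<Longrightarrow> P k \<Longrightarrow> a \<le> g k" "1 \<le> a" "B \<le> card {k. k < n \<and> P k}"
  shows "a ^ B \<le> (\<Prod>k<n. g k)"
proof -
  have "a ^ B \<le> a ^ card {k. k < n \<and> P k}" using assms by (intro power_increasing) auto
  also have "\<dots> = (\<Prod>k\<in>{k \<in> {..<n}. P k}. a)" by simp
  also have "\<dots> = (\<Prod>k<n. if P k then a else 1)" by (subst prod.inter_filter[symmetric]) auto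
  also have "\<dots> \<le> (\<Prod>k<n. g k)" using assms by (intro prod_mono_ennreal) auto
  finally show ?thesis .
qed

text \<open>A lower-tail Chernoff bound. By \<open>wB\<close> the expected number of candidates in
  the interval is \<open>6/5 * B\<close>, so fewer than \<open>B\<close> of them is exponentially
  unlikely.\<close>

lemma expected_enough_ge:
  assumes "0 \<le> w" "\<bar>c\<bar> + w \<le> pi/2" "n > 0" and wB: "2 * w * real n = 6/5 * pi * real B"
  shows "ennreal (1 - (123/125) ^ B) \<le>
    emeasure (candidates n) {z \<in> space (candidates n). B \<le> card {k. k < n \<and> \<bar>z k - c\<bar> \<le> w}}"
proof -
  let ?N = "uniform_measure lborel {-pi/2..pi/2}"
  let ?E = "{z \<in> space (candidates n). B \<le> card {k. k < n \<and> \<bar>z k - c\<bar> \<le> w}}"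
  interpret C: prob_space "candidates n" by (rule prob_space_candidates)
  interpret N: prob_space ?N by (rule prob_space_candidate)
  \<comment> \<open>A sum of indicators makes measurability of the counting event routine.\<close>
  have card_sum: "card {k. k < n \<and> \<bar>z k - c\<bar> \<le> w} = (\<Sum>k<n. if \<bar>z k - c\<bar> \<le> w then 1 else 0)" for z
    by (subst sum.inter_filter[symmetric]) (auto intro!: arg_cong[where f = card])
  have E: "?E \<in> sets (candidates n)" unfolding card_sum by measurable
  \<comment> \<open>The factor is \<open>5/6\<close> inside the interval and \<open>1\<close>
    outside. The value \<open>5/6\<close> is the ratio of \<open>B\<close> to the expected count,
    the optimal Chernoff weight.\<close>
  define g :: "real \<Rightarrow> ennreal" where "g x = (if w < \<bar>x - c\<bar> then ennreal (1/6) else 0) + ennreal (5/6)" for x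
  have [measurable]: "g \<in> borel_measurable borel" unfolding g_def by measurable
  have Ng: "(\<integral>\<^sup>+x. g x \<partial>?N) \<le> ennreal (1 - 1/6 * (2 * w / pi))"
  proof -
    have "(\<integral>\<^sup>+x. g x \<partial>?N) = (\<integral>\<^sup>+x. ennreal (1/6) * indicator {x. w < \<bar>x - c\<bar>} x + ennreal (5/6) \<partial>?N)"
      by (intro nn_integral_cong) (auto simp: indicator_def g_def)
    also have "\<dots> = ennreal (1/6) * emeasure ?N {x. w < \<bar>x - c\<bar>} + ennreal (5/6)"
      using N.emeasure_space_1 by (subst nn_integral_add) (auto simp: nn_integral_cmult)
    also have "\<dots> \<le> ennreal (1/6) * ennreal (1 - 2 * w / pi) + ennreal (5/6)"
      using emeasure_candidate_far_le[OF assms(1,2)] by (intro add_right_mono mult_left_mono) auto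
    also have "\<dots> = ennreal (1 - 1/6 * (2 * w / pi))"
      using assms by (simp add: ennreal_mult[symmetric] ennreal_plus[symmetric] field_simps del: ennreal_plus)
    finally show ?thesis .
  qed
  have w1: "1/6 * (2 * w / pi) \<le> 1" using assms by (simp add: field_simps)
  have "ennreal ((5/6) ^ B) * emeasure (candidates n) (space (candidates n) - ?E)
     = (\<integral>\<^sup>+z. ennreal ((5/6) ^ B) * indicator (space (candidates n) - ?E) z \<partial>candidates n)"
    using E by (subst nn_integral_cmult_indicator) auto
  also have "\<dots> \<le> (\<integral>\<^sup>+z. (\<Prod>k<n. g (z k)) \<partial>candidates n)"
  proof (rule nn_integral_mono)
    fix z assume z: "z \<in> space (candidates n)"
    show "ennreal ((5/6) ^ B) * indicator (space (candidates n) - ?E) z \<le> (\<Prod>k<n. g (z k))"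
    proof (cases "z \<in> ?E")
      case False
      then have "card {k. k < n \<and> \<bar>z k - c\<bar> \<le> w} \<le> B" using z by simp
      then have "(5/6::real) ^ B \<le> (5/6) ^ card {k. k < n \<and> \<bar>z k - c\<bar> \<le> w}"
        by (intro power_decreasing) auto
      also have "(5/6::real) ^ card {k. k < n \<and> \<bar>z k - c\<bar> \<le> w} = (\<Prod>k\<in>{k \<in> {..<n}. \<bar>z k - c\<bar> \<le> w}. 5/6)" by simp
      also have "\<dots> = (\<Prod>k<n. if \<bar>z k - c\<bar> \<le> w then 5/6 else 1)" by (subst prod.inter_filter[symmetric]) auto
      finally have "ennreal ((5/6) ^ B) \<le> ennreal (\<Prod>k<n. if \<bar>z k - c\<bar> \<le> w then 5/6 else 1)"
        by (rule ennreal_leI)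
      also have "\<dots> = (\<Prod>k<n. ennreal (if \<bar>z k - c\<bar> \<le> w then 5/6 else 1))" by (rule prod_ennreal[symmetric]) auto
      also have "\<dots> = (\<Prod>k<n. g (z k))"
        by (intro prod.cong) (auto simp: g_def ennreal_plus[symmetric] simp del: ennreal_plus)
      finally show ?thesis by (simp add: indicator_def)
    qed auto
  qed
  also have "\<dots> = (\<integral>\<^sup>+x. g x \<partial>?N) ^ n"
    by (subst nn_integral_prod_iid[OF prob_space_candidate]) auto
  also have "\<dots> \<le> ennreal (1 - 1/6 * (2 * w / pi)) ^ n" using Ng by (intro power_mono) auto
  also have "\<dots> = ennreal ((1 - 1/6 * (2 * w / pi)) ^ n)" using w1 by (simp add: ennreal_power)
  also have "\<dots> \<le> ennreal ((41/50) ^ B)"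
  proof (rule ennreal_leI)
    have "(1 - 1/6 * (2 * w / pi)) ^ n \<le> exp (- (1/6 * (2 * w / pi)) * real n)"
      by (rule power_one_minus_le_exp[OF w1])
    also have "- (1/6 * (2 * w / pi)) * real n = - (1/5) * real B"
      using wB by (simp add: field_simps)
    also have "exp (- (1/5) * real B) = exp (- (1/5)) ^ B"
      by (simp add: exp_of_nat_mult[symmetric] mult.commute)
    also have "\<dots> \<le> (41/50) ^ B"
    proof (intro power_mono)
      \<comment> \<open>The quadratic Taylor bound gives \<open>exp (1/5) \<ge> 1.22\<close>; the
        resulting base \<open>41/50\<close> divided by \<open>5/6\<close> is the
        \<open>123/125\<close> of the statement.\<close>
      have "50/41 \<le> (1 + (1/5) + (1/5)\<^sup>2/2 :: real)" by (simp add: power2_eq_square)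
      also have "\<dots> \<le> exp (1/5 :: real)" by (rule exp_lower_Taylor_quadratic) simp
      finally have "50/41 \<le> exp (1/5 :: real)" .
      then show "exp (- (1/5)) \<le> (41/50::real)" by (simp add: exp_minus field_simps)
    qed simp
    finally show "(1 - 1/6 * (2 * w / pi)) ^ n \<le> (41/50) ^ B" .
  qed
  finally have "ennreal ((5/6) ^ B) * emeasure (candidates n) (space (candidates n) - ?E) \<le> ennreal ((41/50) ^ B)" .
  then have "(5/6) ^ B * C.prob (space (candidates n) - ?E) \<le> (41/50) ^ B"
    unfolding C.emeasure_eq_measure by (subst (asm) ennreal_mult[symmetric]) auto
  then have "C.prob (space (candidates n) - ?E) \<le> (41/50) ^ B / (5/6) ^ B"
    by (subst pos_le_divide_eq) (simp_all only: mult.commute, simp)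
  also have "\<dots> = (123/125) ^ B" by (simp add: power_divide[symmetric])
  finally have "1 - (123/125) ^ B \<le> C.prob ?E" unfolding C.prob_compl[OF E] by linarith
  then show ?thesis unfolding C.emeasure_eq_measure by (rule ennreal_leI)
qed

subsection \<open>Min-margin sampling\<close>

lemma prob_space_positive_sample: "prob_space (positive_sample m)"
  by (intro prob_space_PiM prob_space_positive)

lemma prob_space_negative_sample: "prob_space (negative_sample m)"
  by (intro prob_space_PiM prob_space_negative)

lemma nn_integral_data_measure:
  assumes [measurable]: "(\<lambda>(p, q, z). G p q z) \<in> borel_measurable (data_measure m n)"
  shows "(\<integral>\<^sup>+ (p, q, z). G p q z \<partial>data_measure m n) =
    (\<integral>\<^sup>+p. (\<integral>\<^sup>+q. (\<integral>\<^sup>+z. G p q z \<partial>candidates n) \<partial>negative_sample m) \<partial>positive_sample m)"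
proof -
  interpret Q: prob_space "negative_sample m" by (rule prob_space_negative_sample)
  interpret Z: prob_space "candidates n" by (rule prob_space_candidates)
  interpret QZ: pair_prob_space "negative_sample m" "candidates n" by unfold_locales
  have m: "(\<lambda>(p, q, z). G p q z) \<in> borel_measurable (positive_sample m \<Otimes>\<^sub>M (negative_sample m \<Otimes>\<^sub>M candidates n))"
    using assms by (simp only: data_measure_def)
  have "(\<integral>\<^sup>+ (p, q, z). G p q z \<partial>data_measure m n) =
    (\<integral>\<^sup>+p. (\<integral>\<^sup>+y. (case (p, y) of (p, q, z) \<Rightarrow> G p q z) \<partial>(negative_sample m \<Otimes>\<^sub>M candidates n)) \<partial>positive_sample m)"
    unfolding data_measure_def by (rule QZ.P.nn_integral_fst[OF m, symmetric])
  also have "\<dots> = (\<integral>\<^sup>+p. (\<integral>\<^sup>+q. (\<integral>\<^sup>+z. G p q z \<partial>candidates n) \<partial>negative_sample m) \<partial>positive_sample m)"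
  proof (rule nn_integral_cong)
    fix p assume p: "p \<in> space (positive_sample m)"
    have "(\<lambda>y. case (p, y) of (p, q, z) \<Rightarrow> G p q z) \<in> borel_measurable (negative_sample m \<Otimes>\<^sub>M candidates n)"
      by (rule measurable_compose[OF measurable_Pair1'[OF p] m])
    from Z.nn_integral_fst[OF this]
    show "(\<integral>\<^sup>+y. (case (p, y) of (p, q, z) \<Rightarrow> G p q z) \<partial>(negative_sample m \<Otimes>\<^sub>M candidates n)) =
      (\<integral>\<^sup>+q. (\<integral>\<^sup>+z. G p q z \<partial>candidates n) \<partial>negative_sample m)"
      by simp
  qed
  finally show ?thesis .
qed

lemma AE_PiM_uniform:
  assumes "A \<in> sets borel" "prob_space (uniform_measure lborel A)"
  shows "AE x in PiM {..<m::nat} (\<lambda>_. uniform_measure lborel A). \<forall>i\<in>{..<m}. x i \<in> A"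
  using assms by (intro AE_finite_allI AE_PiM_component AE_uniform_measureI) auto

text \<open>Lets the deterministic bounds, which assume all angles in their ranges, be used under
  the integral.\<close>

lemma AE_data_measure:
  "AE (p, q, z) in data_measure m n. (\<forall>i\<in>{..<m}. p i \<in> {0<..pi/2}) \<and>
     (\<forall>i\<in>{..<m}. q i \<in> {-pi/2..<0}) \<and> (\<forall>k\<in>{..<n}. z k \<in> {-pi/2..pi/2})"
proof -
  interpret P: prob_space "positive_sample m" by (rule prob_space_positive_sample)
  interpret Q: prob_space "negative_sample m" by (rule prob_space_negative_sample)
  interpret Z: prob_space "candidates n" by (rule prob_space_candidates)
  interpret QZ: pair_prob_space "negative_sample m" "candidates n" by unfold_locales
  interpret PQZ: pair_prob_space "positive_sample m" "negative_sample m \<Otimes>\<^sub>M candidates n" by unfold_locales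
  have P: "AE p in positive_sample m. \<forall>i\<in>{..<m}. p i \<in> {0<..pi/2}"
    by (rule AE_PiM_uniform[OF _ prob_space_positive]) simp
  have Q: "AE q in negative_sample m. \<forall>i\<in>{..<m}. q i \<in> {-pi/2..<0}"
    by (rule AE_PiM_uniform[OF _ prob_space_negative]) simp
  have Z: "AE z in candidates n. \<forall>k\<in>{..<n}. z k \<in> {-pi/2..pi/2}"
    by (rule AE_PiM_uniform[OF _ prob_space_candidate]) simp
  have QZ: "AE y in negative_sample m \<Otimes>\<^sub>M candidates n.
      (\<forall>i\<in>{..<m}. fst y i \<in> {-pi/2..<0}) \<and> (\<forall>k\<in>{..<n}. snd y k \<in> {-pi/2..pi/2})"
  proof (rule QZ.AE_pair_measure)
    show "AE q in negative_sample m. AE z in candidates n.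
      (\<forall>i\<in>{..<m}. fst (q, z) i \<in> {-pi/2..<0}) \<and> (\<forall>k\<in>{..<n}. snd (q, z) k \<in> {-pi/2..pi/2})"
      using Q by eventually_elim (use Z in auto)
  qed measurable
  have "AE x in positive_sample m \<Otimes>\<^sub>M (negative_sample m \<Otimes>\<^sub>M candidates n).
      (\<forall>i\<in>{..<m}. fst x i \<in> {0<..pi/2}) \<and>
      (\<forall>i\<in>{..<m}. fst (snd x) i \<in> {-pi/2..<0}) \<and> (\<forall>k\<in>{..<n}. snd (snd x) k \<in> {-pi/2..pi/2})"
  proof (rule PQZ.AE_pair_measure)
    show "AE p in positive_sample m. AE y in negative_sample m \<Otimes>\<^sub>M candidates n.
      (\<forall>i\<in>{..<m}. fst (p, y) i \<in> {0<..pi/2}) \<and>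
      (\<forall>i\<in>{..<m}. fst (snd (p, y)) i \<in> {-pi/2..<0}) \<and> (\<forall>k\<in>{..<n}. snd (snd (p, y)) k \<in> {-pi/2..pi/2})"
      using P by eventually_elim (use QZ in auto)
  qed measurable
  then show ?thesis unfolding data_measure_def by (simp add: case_prod_beta)
qed

text \<open>Young's inequality weighted so that the main term loses only one percent; the large
  factor falls on \<open>d\<^sup>2\<close>, which is of much lower order.\<close>

lemma sum_square_le:
  fixes a b :: real
  shows "(a + b)\<^sup>2 \<le> 101/100 * a\<^sup>2 + 101 * b\<^sup>2"
proof -
  have "0 \<le> (a / 10 - 10 * b)\<^sup>2" by simp
  then show ?thesis by (simp add: power2_eq_square algebra_simps)
qed

text \<open>\<open>Theta_star\<close> is dominated by a measurable function and integrated over the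
  candidates, then the negatives, then the positives. The five summands account for the nearest
  negative angle, the absence of a positive angle in the middle half, the radius \<open>d\<close>, a
  missed neighbourhood, and crowding.\<close>

lemma expected_min_margin_le:
  assumes "\<beta> \<ge> 1 / real m" "m > 0" "n > 0" "B > 0" and d: "0 \<le> d" "d < pi/4"
  shows "(\<integral>\<^sup>+ (p, q, z). ennreal (Theta_star z
            (select_lowest (\<lambda>i. min_margin_score m \<beta> p q (z i)) n B)) \<partial>data_measure m n)
    \<le> ennreal (101/400 * ((pi/2)\<^sup>2 * (1 / (2 * ((real m + 1) * (real m + 2))) + (1/2) ^ m))
        + 101/400 * (pi/2)\<^sup>2 * (1/2) ^ m + 101 * d\<^sup>2 + (pi/2)\<^sup>2 * exp (- (2 * d / pi) * real n)
        + (pi/2)\<^sup>2 / (10/9) ^ B * exp (1/9 * ((real m)\<^sup>2 * (2 * d / pi)) * real n))"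
proof -
  define F where "F = {..<m} \<times> {..<m}"
  have F: "finite F" "F \<noteq> {}" "card F = m\<^sup>2"
    using assms(2) by (auto simp: F_def power2_eq_square lessThan_empty_iff)
  define miss :: "(nat \<Rightarrow> real) \<Rightarrow> real \<Rightarrow> ennreal" where
    "miss z c = (\<Prod>k<n. if d < \<bar>z k - c\<bar> then 1 else 0)" for z c
  \<comment> \<open>The increment \<open>1/9\<close> is the optimal Chernoff choice when the
    expected count is \<open>9/10 * B\<close>: the factor \<open>10/9\<close> is \<open>B\<close>
    over that count. Division by \<open>(10/9) ^ B\<close> in \<open>?h'\<close> completes Markov's
    inequality.\<close>
  define crowd :: "(nat \<Rightarrow> real) \<Rightarrow> (nat \<Rightarrow> real) \<Rightarrow> (nat \<Rightarrow> real) \<Rightarrow> ennreal" where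
    "crowd p q z = (\<Prod>k<n. 1 + ennreal (1/9) * (\<Sum>x\<in>F. if \<bar>z k - (p (fst x) + q (snd x)) / 2\<bar> \<le> d then 1 else 0))" for p q z
  define near :: "real \<Rightarrow> ennreal" where
    "near s = ennreal (101/400) * ennreal (s\<^sup>2) + ennreal (101 * d\<^sup>2)" for s
  let ?h = "ennreal ((pi/2)\<^sup>2)" and ?h' = "ennreal ((pi/2)\<^sup>2 / (10/9) ^ B)"
  let ?e1 = "exp (- (2 * d / pi) * real n)" and ?e2 = "exp (1/9 * ((real m)\<^sup>2 * (2 * d / pi)) * real n)"
  let ?c = "ennreal (101 * d\<^sup>2) + (?h * ennreal ?e1 + ?h' * ennreal ?e2)"
  let ?U = "(pi/2)\<^sup>2 * (1 / (2 * ((real m + 1) * (real m + 2))) + (1/2) ^ m)"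
  have U_nonneg: "0 \<le> ?U" by simp
  have ne: "{..<m} \<noteq> {}" using assms(2) by (auto simp: lessThan_empty_iff)
  have P_range: "AE p in positive_sample m. \<forall>i\<in>{..<m}. p i \<in> {0<..pi/2}"
    by (rule AE_PiM_uniform[OF _ prob_space_positive]) simp
  have Q_range: "AE q in negative_sample m. \<forall>i\<in>{..<m}. q i \<in> {-pi/2..<0}"
    by (rule AE_PiM_uniform[OF _ prob_space_negative]) simp
  \<comment> \<open>The infimum over pairs allows the pair to be chosen later as a function of
    \<open>p\<close> and \<open>q\<close>; the crowding term concerns all pairs at once and stays
    outside.\<close>
  define G where "G p q z = (INF x\<in>F. near (p (fst x) + q (snd x)) + ?h * miss z ((p (fst x) + q (snd x)) / 2))
      + ?h' * crowd p q z" for p q z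
  have [measurable]: "(\<lambda>w. fst w (fst x)) \<in> borel_measurable (data_measure m n)"
    "(\<lambda>w. fst (snd w) (snd x)) \<in> borel_measurable (data_measure m n)" if "x \<in> F" for x
    using that by (auto simp: data_measure_def F_def)
  have [measurable]: "(\<lambda>w. snd (snd w) k) \<in> borel_measurable (data_measure m n)" if "k \<in> {..<n}" for k
    using that by (simp add: data_measure_def)
  have G_meas: "(\<lambda>(p, q, z). G p q z) \<in> borel_measurable (data_measure m n)"
    unfolding G_def near_def miss_def crowd_def case_prod_beta using F(1) by measurable
  have "(\<integral>\<^sup>+ (p, q, z). ennreal (Theta_star z
            (select_lowest (\<lambda>i. min_margin_score m \<beta> p q (z i)) n B)) \<partial>data_measure m n)
     \<le> (\<integral>\<^sup>+ (p, q, z). G p q z \<partial>data_measure m n)"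
  proof (rule nn_integral_mono_AE, use AE_data_measure[of m n] in eventually_elim, clarify)
    fix p q z assume rng: "\<forall>i\<in>{..<m}. p i \<in> {0<..pi/2}" "\<forall>i\<in>{..<m}. q i \<in> {-pi/2..<0}"
      "\<forall>k\<in>{..<n}. z k \<in> {-pi/2..pi/2}"
    let ?T = "Theta_star z (select_lowest (\<lambda>i. min_margin_score m \<beta> p q (z i)) n B)"
    obtain x where x: "x \<in> F" "(INF x\<in>F. near (p (fst x) + q (snd x)) + ?h * miss z ((p (fst x) + q (snd x)) / 2))
       = near (p (fst x) + q (snd x)) + ?h * miss z ((p (fst x) + q (snd x)) / 2)"
      by (rule INF_image_attained[OF F(1,2), of "\<lambda>x. near (p (fst x) + q (snd x)) + ?h * miss z ((p (fst x) + q (snd x)) / 2)"])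
    obtain i j where ij: "x = (i, j)" "i < m" "j < m" using x(1) by (auto simp: F_def)
    have "?T \<le> (\<bar>p i + q j\<bar> / 2 + d)\<^sup>2 \<or>
       ?T \<le> (pi / 2)\<^sup>2 \<and> (\<forall>k<n. \<bar>z k - (p i + q j) / 2\<bar> > d) \<or>
       ?T \<le> (pi / 2)\<^sup>2 \<and> B \<le> card {k. k < n \<and> (\<exists>i<m. \<exists>j<m. \<bar>z k - (p i + q j) / 2\<bar> \<le> d)}"
      by (rule Theta_star_min_margin_cases[of m \<beta> n B p q z d i j])
         (use assms rng ij in auto)
    then consider "?T \<le> (\<bar>p i + q j\<bar> / 2 + d)\<^sup>2"
      | "?T \<le> (pi / 2)\<^sup>2" "\<forall>k<n. \<bar>z k - (p i + q j) / 2\<bar> > d"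
      | "?T \<le> (pi / 2)\<^sup>2" "B \<le> card {k. k < n \<and> (\<exists>i<m. \<exists>j<m. \<bar>z k - (p i + q j) / 2\<bar> \<le> d)}"
      by blast
    then have "ennreal ?T \<le> near (p i + q j) + ?h * miss z ((p i + q j) / 2) + ?h' * crowd p q z"
    proof cases
      case 1
      also have "(\<bar>p i + q j\<bar> / 2 + d)\<^sup>2 \<le> 101/400 * (p i + q j)\<^sup>2 + 101 * d\<^sup>2"
        using sum_square_le[of "\<bar>p i + q j\<bar> / 2" d] by (simp add: power_divide)
      finally have "ennreal ?T \<le> ennreal (101/400 * (p i + q j)\<^sup>2 + 101 * d\<^sup>2)" by (rule ennreal_leI)
      also have "\<dots> = near (p i + q j)"
        unfolding near_def
        by (subst ennreal_mult[symmetric], simp, simp, subst ennreal_plus[symmetric], simp, simp, rule refl)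
      finally show ?thesis by (intro add_increasing2 zero_le)
    next
      case 2
      have "miss z ((p i + q j) / 2) = 1" using 2(2) by (simp add: miss_def)
      moreover have "ennreal ?T \<le> ?h" using 2(1) by (rule ennreal_leI)
      ultimately have "ennreal ?T \<le> ?h * miss z ((p i + q j) / 2)" by simp
      then show ?thesis by (intro add_increasing2[OF zero_le] add_increasing[OF zero_le])
    next
      case 3
      have "ennreal (10/9) ^ B \<le> crowd p q z"
        unfolding crowd_def
      proof (rule power_card_le_prod[OF _ _ _ 3(2)])
        fix k assume "\<exists>i<m. \<exists>j<m. \<bar>z k - (p i + q j) / 2\<bar> \<le> d"
        then obtain y where y: "y \<in> F" "\<bar>z k - (p (fst y) + q (snd y)) / 2\<bar> \<le> d"
          by (force simp: F_def)
        have "1 \<le> (\<Sum>x\<in>F. if \<bar>z k - (p (fst x) + q (snd x)) / 2\<bar> \<le> d then 1 else 0::ennreal)"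
          using member_le_sum[OF y(1), of "\<lambda>x. if \<bar>z k - (p (fst x) + q (snd x)) / 2\<bar> \<le> d then 1 else 0::ennreal"] y(2) F(1)
          by simp
        then have "ennreal (1/9) * 1 \<le> ennreal (1/9) * (\<Sum>x\<in>F. if \<bar>z k - (p (fst x) + q (snd x)) / 2\<bar> \<le> d then 1 else 0)"
          by (intro mult_left_mono) auto
        then have le: "1 + ennreal (1/9) * 1 \<le> 1 + ennreal (1/9) * (\<Sum>x\<in>F. if \<bar>z k - (p (fst x) + q (snd x)) / 2\<bar> \<le> d then 1 else 0)"
          by (rule add_left_mono)
        have "ennreal (10/9) = 1 + ennreal (1/9) * 1"
          using ennreal_plus[of 1 "1/9"] by simp
        then show "ennreal (10/9) \<le> 1 + ennreal (1/9) * (\<Sum>x\<in>F. if \<bar>z k - (p (fst x) + q (snd x)) / 2\<bar> \<le> d then 1 else 0)"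
          using le by (simp only:)
      qed auto
      then have "?h' * ennreal (10/9) ^ B \<le> ?h' * crowd p q z" by (intro mult_left_mono) auto
      moreover have "?h' * ennreal (10/9) ^ B = ?h"
        by (subst ennreal_power, simp, subst ennreal_mult[symmetric], simp, simp) simp
      moreover have "ennreal ?T \<le> ?h" using 3(1) by (rule ennreal_leI)
      ultimately have "ennreal ?T \<le> ?h' * crowd p q z" by (simp only: order_trans)
      then show ?thesis by (intro add_increasing zero_le)
    qed
    then show "ennreal ?T \<le> G p q z" unfolding G_def x(2) by (simp add: ij)
  qed
  also have "\<dots> = (\<integral>\<^sup>+p. (\<integral>\<^sup>+q. (\<integral>\<^sup>+z. G p q z \<partial>candidates n) \<partial>negative_sample m) \<partial>positive_sample m)"
    by (rule nn_integral_data_measure[OF G_meas])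
  also have "\<dots> \<le> (\<integral>\<^sup>+p. ennreal (101/400) * ennreal ?U + ?c +
        ennreal (101/400) * ?h * (\<Prod>i<m. if p i \<in> {pi/8..3*pi/8} then 0 else 1) \<partial>positive_sample m)"
  proof (rule nn_integral_mono_AE, use P_range in eventually_elim)
    fix p assume p: "\<forall>i\<in>{..<m}. p i \<in> {0<..pi/2}"
    have Gz: "(\<integral>\<^sup>+z. G p q z \<partial>candidates n) \<le> ennreal (101/400) * ennreal ((p i + q j)\<^sup>2) + ?c"
      if q: "\<forall>i\<in>{..<m}. q i \<in> {-pi/2..<0}" and ij: "i < m" "j < m" for q i j
    proof -
      let ?s = "p i + q j"
      have "p i \<in> {0<..pi/2}" "q j \<in> {-pi/2..<0}" using p q ij by auto
      then have "\<bar>?s\<bar> \<le> pi/2" unfolding abs_le_iff by auto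
      \<comment> \<open>The bisector angle is at most \<open>pi/4\<close> in absolute value and
        \<open>d < pi/4\<close>, so the neighbourhood lies within the candidates' range.\<close>
      then have s: "\<bar>?s / 2\<bar> + d \<le> pi/2" using d by simp
      have "(\<integral>\<^sup>+z. G p q z \<partial>candidates n) \<le>
        (\<integral>\<^sup>+z. near ?s + ?h * miss z (?s / 2) + ?h' * crowd p q z \<partial>candidates n)"
        unfolding G_def using ij
        by (intro nn_integral_mono add_right_mono INF_lower2[of "(i, j)"]) (auto simp: F_def)
      also have "\<dots> = near ?s + ?h * (\<integral>\<^sup>+z. miss z (?s / 2) \<partial>candidates n) + ?h' * (\<integral>\<^sup>+z. crowd p q z \<partial>candidates n)"
      proof -
        have m: "(\<lambda>z. miss z (?s / 2)) \<in> borel_measurable (candidates n)"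
          "(\<lambda>z. crowd p q z) \<in> borel_measurable (candidates n)"
          unfolding miss_def crowd_def by measurable
        have m': "(\<lambda>z. ?h * miss z (?s / 2)) \<in> borel_measurable (candidates n)"
          "(\<lambda>z. ?h' * crowd p q z) \<in> borel_measurable (candidates n)"
          using m by measurable
        have "(\<integral>\<^sup>+z. near ?s \<partial>candidates n) = near ?s"
          unfolding nn_integral_const prob_space.emeasure_space_1[OF prob_space_candidates] by simp
        then show ?thesis
          unfolding nn_integral_add[OF borel_measurable_add[OF borel_measurable_const m'(1)] m'(2)]
            nn_integral_add[OF borel_measurable_const m'(1)] nn_integral_cmult[OF m(1)] nn_integral_cmult[OF m(2)]
          by (simp only:)
      qed
      also have "\<dots> \<le> near ?s + ?h * ennreal ?e1 + ?h' * ennreal ?e2"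
      proof (intro add_mono mult_left_mono order_refl)
        show "(\<integral>\<^sup>+z. miss z (?s / 2) \<partial>candidates n) \<le> ennreal ?e1"
          unfolding miss_def by (rule expected_missed_le[OF d(1) s])
        show "(\<integral>\<^sup>+z. crowd p q z \<partial>candidates n) \<le> ennreal ?e2"
          using expected_crowded_le[OF d(1) _ F(1), where l = "1/9" and n = n and c = "\<lambda>x. (p (fst x) + q (snd x)) / 2"]
          unfolding crowd_def F(3) by simp
      qed auto
      also have "\<dots> = ennreal (101/400) * ennreal (?s\<^sup>2) + ?c"
        unfolding near_def by (simp only: add.assoc)
      finally show ?thesis .
    qed
    have Gq: "(\<integral>\<^sup>+q. (\<integral>\<^sup>+z. G p q z \<partial>candidates n) \<partial>negative_sample m) \<le>
        ennreal (101/400) * (\<integral>\<^sup>+q. (INF j\<in>{..<m}. ennreal ((p i + q j)\<^sup>2)) \<partial>negative_sample m) + ?c"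
      if i: "i < m" for i
    proof -
      have "(\<integral>\<^sup>+q. (\<integral>\<^sup>+z. G p q z \<partial>candidates n) \<partial>negative_sample m) \<le>
        (\<integral>\<^sup>+q. ennreal (101/400) * (INF j\<in>{..<m}. ennreal ((p i + q j)\<^sup>2)) + ?c \<partial>negative_sample m)"
      proof (rule nn_integral_mono_AE, use Q_range in eventually_elim)
        fix q assume q: "\<forall>i\<in>{..<m}. q i \<in> {-pi/2..<0}"
        \<comment> \<open>For the given positive angle, the negative angle most nearly opposite to
          it is used.\<close>
        obtain j where j: "j \<in> {..<m}" "(INF j\<in>{..<m}. ennreal ((p i + q j)\<^sup>2)) = ennreal ((p i + q j)\<^sup>2)"
          by (rule INF_image_attained[OF finite_lessThan ne, of "\<lambda>j. ennreal ((p i + q j)\<^sup>2)"])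
        show "(\<integral>\<^sup>+z. G p q z \<partial>candidates n) \<le> ennreal (101/400) * (INF j\<in>{..<m}. ennreal ((p i + q j)\<^sup>2)) + ?c"
          unfolding j(2) using j(1) by (intro Gz[OF q i]) simp
      qed
      also have "\<dots> = ennreal (101/400) * (\<integral>\<^sup>+q. (INF j\<in>{..<m}. ennreal ((p i + q j)\<^sup>2)) \<partial>negative_sample m) + ?c"
      proof -
        have m: "(\<lambda>q. INF j\<in>{..<m}. ennreal ((p i + q j)\<^sup>2)) \<in> borel_measurable (negative_sample m)"
          by measurable
        have m': "(\<lambda>q. ennreal (101/400) * (INF j\<in>{..<m}. ennreal ((p i + q j)\<^sup>2))) \<in> borel_measurable (negative_sample m)"
          using m by measurable
        have "(\<integral>\<^sup>+q. ?c \<partial>negative_sample m) = ?c"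
          unfolding nn_integral_const prob_space.emeasure_space_1[OF prob_space_negative_sample] by simp
        then show ?thesis
          unfolding nn_integral_add[OF m' borel_measurable_const]
            nn_integral_cmult[OF m] by (simp only:)
      qed
      finally show ?thesis .
    qed
    show "(\<integral>\<^sup>+q. (\<integral>\<^sup>+z. G p q z \<partial>candidates n) \<partial>negative_sample m) \<le>
      ennreal (101/400) * ennreal ?U + ?c + ennreal (101/400) * ?h * (\<Prod>i<m. if p i \<in> {pi/8..3*pi/8} then 0 else 1)"
    proof (cases "\<exists>i<m. p i \<in> {pi/8..3*pi/8}")
      case True
      then obtain i where i: "i < m" "p i \<in> {pi/8..3*pi/8}" by blast
      have "ennreal (101/400) * (\<integral>\<^sup>+q. (INF j\<in>{..<m}. ennreal ((p i + q j)\<^sup>2)) \<partial>negative_sample m)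
        \<le> ennreal (101/400) * ennreal ?U"
        by (intro mult_left_mono expected_nearest_le[OF i(2) assms(2)]) simp
      then have "(\<integral>\<^sup>+q. (\<integral>\<^sup>+z. G p q z \<partial>candidates n) \<partial>negative_sample m) \<le> ennreal (101/400) * ennreal ?U + ?c"
        by (rule order_trans[OF Gq[OF i(1)] add_right_mono])
      then show ?thesis by (rule order_trans) (intro add_increasing2 order_refl zero_le)
    next
      case False
      then have one: "(\<Prod>i<m. if p i \<in> {pi/8..3*pi/8} then 0 else 1 :: ennreal) = 1" by (intro prod.neutral) auto
      have "(\<integral>\<^sup>+q. (INF j\<in>{..<m}. ennreal ((p 0 + q j)\<^sup>2)) \<partial>negative_sample m) \<le> (\<integral>\<^sup>+q. ?h \<partial>negative_sample m)"
      proof (rule nn_integral_mono_AE, use Q_range in eventually_elim)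
        fix q assume q: "\<forall>i\<in>{..<m}. q i \<in> {-pi/2..<0}"
        have "p 0 \<in> {0<..pi/2}" "q 0 \<in> {-pi/2..<0}" using p q assms(2) by auto
        then have "\<bar>p 0 + q 0\<bar> \<le> \<bar>pi/2\<bar>" unfolding abs_le_iff by auto
        then have "(p 0 + q 0)\<^sup>2 \<le> (pi/2)\<^sup>2" by (simp only: abs_le_square_iff)
        then show "(INF j\<in>{..<m}. ennreal ((p 0 + q j)\<^sup>2)) \<le> ?h"
          using assms(2) by (intro INF_lower2[of 0] ennreal_leI) auto
      qed
      also have "\<dots> = ?h"
        unfolding nn_integral_const prob_space.emeasure_space_1[OF prob_space_negative_sample] by simp
      finally have "ennreal (101/400) * (\<integral>\<^sup>+q. (INF j\<in>{..<m}. ennreal ((p 0 + q j)\<^sup>2)) \<partial>negative_sample m)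
        \<le> ennreal (101/400) * ?h" by (intro mult_left_mono) auto
      then have "(\<integral>\<^sup>+q. (\<integral>\<^sup>+z. G p q z \<partial>candidates n) \<partial>negative_sample m) \<le> ennreal (101/400) * ?h + ?c"
        by (rule order_trans[OF Gq[OF assms(2)] add_right_mono])
      also have "\<dots> \<le> ennreal (101/400) * ?h + (ennreal (101/400) * ennreal ?U + ?c)"
        by (intro add_left_mono add_increasing order_refl zero_le)
      finally show ?thesis unfolding one mult_1_right by (simp only: add.commute)
    qed
  qed
  also have "\<dots> = ennreal (101/400) * ennreal ?U + ?c +
     ennreal (101/400) * ?h * (\<integral>\<^sup>+p. (\<Prod>i<m. if p i \<in> {pi/8..3*pi/8} then 0 else 1) \<partial>positive_sample m)"
  proof -
    have m: "(\<lambda>p. (\<Prod>i<m. if p i \<in> {pi/8..3*pi/8} then 0 else 1 :: ennreal)) \<in> borel_measurable (positive_sample m)"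
      by measurable
    have m': "(\<lambda>p. ennreal (101/400) * ?h * (\<Prod>i<m. if p i \<in> {pi/8..3*pi/8} then 0 else 1)) \<in> borel_measurable (positive_sample m)"
      using m by measurable
    have "(\<integral>\<^sup>+p. ennreal (101/400) * ennreal ?U + ?c \<partial>positive_sample m) = ennreal (101/400) * ennreal ?U + ?c"
      unfolding nn_integral_const prob_space.emeasure_space_1[OF prob_space_positive_sample] by simp
    then show ?thesis
      unfolding nn_integral_add[OF borel_measurable_const m']
        nn_integral_cmult[OF m] by (simp only:)
  qed
  also have "\<dots> \<le> ennreal (101/400) * ennreal ?U + ?c + ennreal (101/400) * ?h * ennreal ((1/2) ^ m)"
  proof (intro add_left_mono mult_left_mono)
    \<comment> \<open>The complement of the middle half has probability \<open>1/2\<close>; all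
      \<open>m\<close> positive angles fall there with probability at most
      \<open>(1/2) ^ m\<close>.\<close>
    have half: "(\<integral>\<^sup>+x. (if x \<in> {pi/8..3*pi/8} then 0 else 1) \<partial>uniform_measure lborel {0<..pi/2}) \<le> ennreal (1/2)"
    proof -
      have "(\<integral>\<^sup>+x. (if x \<in> {pi/8..3*pi/8} then 0 else 1) \<partial>uniform_measure lborel {0<..pi/2})
        = (\<integral>\<^sup>+x. indicator (- {pi/8..3*pi/8}) x \<partial>uniform_measure lborel {0<..pi/2})"
        by (intro nn_integral_cong) (auto simp: indicator_def)
      also have "\<dots> = emeasure (uniform_measure lborel {0<..pi/2}) (- {pi/8..3*pi/8})"
        by (rule nn_integral_indicator) simp
      also have "\<dots> \<le> ennreal ((pi/4) / (pi/2))"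
      proof (rule emeasure_uniform_le[where Y = "{0..pi/8} \<union> {3*pi/8..pi/2}"])
        have "emeasure lborel ({0..pi/8} \<union> {3*pi/8..pi/2}) \<le> emeasure lborel {0..pi/8} + emeasure lborel {3*pi/8..pi/2}"
          by (intro emeasure_subadditive) auto
        also have "\<dots> = ennreal (pi/4)" by (simp add: ennreal_plus[symmetric] del: ennreal_plus)
        finally show "emeasure lborel ({0..pi/8} \<union> {3*pi/8..pi/2}) \<le> ennreal (pi/4)" .
      qed auto
      finally show ?thesis by simp
    qed
    have "(\<integral>\<^sup>+p. (\<Prod>i<m. if p i \<in> {pi/8..3*pi/8} then 0 else 1) \<partial>positive_sample m)
      = (\<integral>\<^sup>+x. (if x \<in> {pi/8..3*pi/8} then 0 else 1) \<partial>uniform_measure lborel {0<..pi/2}) ^ card {..<m}"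
      by (rule nn_integral_prod_iid[OF prob_space_positive]) auto
    also have "\<dots> \<le> ennreal (1/2) ^ m" unfolding card_lessThan by (intro power_mono half) simp
    also have "\<dots> = ennreal ((1/2) ^ m)" by (rule ennreal_power) simp
    finally show "(\<integral>\<^sup>+p. (\<Prod>i<m. if p i \<in> {pi/8..3*pi/8} then 0 else 1) \<partial>positive_sample m) \<le> ennreal ((1/2) ^ m)" .
  qed simp
  also have "\<dots> = ennreal (101/400 * ?U + (101 * d\<^sup>2 + ((pi/2)\<^sup>2 * ?e1 + (pi/2)\<^sup>2 / (10/9) ^ B * ?e2))
     + 101/400 * (pi/2)\<^sup>2 * (1/2) ^ m)"
    by (simp only: ennreal_mult[symmetric] ennreal_plus[symmetric] zero_le_power2 zero_le_power
        zero_le_mult_iff zero_le_divide_iff exp_ge_zero add_nonneg_nonneg mult_nonneg_nonneg divide_nonneg_nonneg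
        U_nonneg zero_le_numeral simp_thms zero_le_one of_nat_0_le_iff)
  finally show ?thesis by (simp only: add.assoc add.commute add.left_commute)
qed

subsection \<open>Margin sampling\<close>

text \<open>The indicators of "all points in \<open>S\<close>" and "some point outside
  \<open>S\<close>" add up to one, and independence bounds the first by
  \<open>b ^ m\<close>.\<close>

lemma expected_some_outside_ge:
  assumes N: "prob_space N" and [measurable_cong]: "sets N = sets borel" and S[measurable]: "S \<in> sets borel"
    and b: "emeasure N S \<le> ennreal b" "0 \<le> b" "b \<le> 1"
  shows "ennreal (1 - b ^ m) \<le> (\<integral>\<^sup>+x. (if \<exists>i\<in>{..<m}. x i \<notin> S then 1 else 0) \<partial>PiM {..<m::nat} (\<lambda>_. N))"
    (is "_ \<le> ?X")
proof -
  interpret M: prob_space "PiM {..<m} (\<lambda>_. N)" by (intro prob_space_PiM N)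
  let ?Y = "\<integral>\<^sup>+x. (\<Prod>i<m. indicator S (x i)) \<partial>PiM {..<m} (\<lambda>_. N)"
  have "?Y = (\<integral>\<^sup>+x. indicator S x \<partial>N) ^ card {..<m}"
    using assms by (intro nn_integral_prod_iid) auto
  also have "(\<integral>\<^sup>+x. indicator S x \<partial>N) = emeasure N S" using assms by (intro nn_integral_indicator) auto
  also have "emeasure N S ^ card {..<m} \<le> ennreal b ^ m" using b by (simp add: power_mono)
  also have "\<dots> = ennreal (b ^ m)" using b by (intro ennreal_power)
  finally have Y: "?Y \<le> ennreal (b ^ m)" .
  have "?Y + ?X = (\<integral>\<^sup>+x. (\<Prod>i<m. indicator S (x i)) + (if \<exists>i\<in>{..<m}. x i \<notin> S then 1 else 0) \<partial>PiM {..<m} (\<lambda>_. N))"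
    by (rule nn_integral_add[symmetric]) measurable
  also have "\<dots> = (\<integral>\<^sup>+x. 1 \<partial>PiM {..<m} (\<lambda>_. N))"
  proof (rule nn_integral_cong)
    fix x
    show "(\<Prod>i<m. indicator S (x i)) + (if \<exists>i\<in>{..<m}. x i \<notin> S then 1 else 0) = (1::ennreal)"
    proof (cases "\<exists>i\<in>{..<m}. x i \<notin> S")
      case True
      then obtain i where "i \<in> {..<m}" "indicator S (x i) = (0::ennreal)" by auto
      then have "(\<Prod>i<m. indicator S (x i)) = (0::ennreal)" by (intro prod_zero) auto
      then show ?thesis using True by simp
    next
      case False
      then have "(\<Prod>i<m. indicator S (x i)) = (1::ennreal)" by (intro prod.neutral) auto
      then show ?thesis using False by simp
    qed
  qed
  also have "\<dots> = 1" using M.emeasure_space_1 by simp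
  finally have "1 - ?Y \<le> ?X" by (simp add: ennreal_minus_le_iff)
  moreover have "1 - ennreal (b ^ m) \<le> 1 - ?Y" using Y by (intro ennreal_mono_minus)
  moreover have "1 - ennreal (b ^ m) = ennreal (1 - b ^ m)" using b by (metis ennreal_1 ennreal_minus zero_le_power)
  ultimately show ?thesis by simp
qed

lemma quarter_square: "ennreal (1/4) * ennreal ((max 0 u)\<^sup>2) = ennreal ((max 0 (u / 2))\<^sup>2)"
proof -
  have "1/4 * (max 0 u)\<^sup>2 = (max 0 (u / 2))\<^sup>2" by (simp add: max_def power_divide)
  then show ?thesis by (subst ennreal_mult[symmetric]) auto
qed

lemma ennreal_symmetric_product:
  fixes u a k :: real
  assumes "0 \<le> u" "0 \<le> a" "0 \<le> k"
  shows "ennreal (u * (a * (k / 2))) = ennreal u * (ennreal (1/4) * (ennreal k * ennreal a + ennreal a * ennreal k))"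
proof -
  have "ennreal k * ennreal a + ennreal a * ennreal k = ennreal (2 * (a * k))"
    using assms by (simp add: ennreal_mult[symmetric] ennreal_plus[symmetric] mult.commute del: ennreal_plus)
  moreover have "ennreal (1/4) * ennreal (2 * (a * k)) = ennreal (a * (k / 2))"
    using assms by (subst ennreal_mult[symmetric]) auto
  moreover have "ennreal u * ennreal (a * (k / 2)) = ennreal (u * (a * (k / 2)))"
    using assms by (intro ennreal_mult[symmetric]) auto
  ultimately show ?thesis by (simp only:)
qed

text \<open>If one innermost angle is at most \<open>e\<close> in size and the other is large, the
  boundary is displaced by at least half the difference. These two conditions concern different
  classes, so independence turns the expectation into a product; symmetry doubles it, and a last
  factor is the probability of having \<open>B\<close> candidates within \<open>w\<close>.\<close>

lemma expected_margin_ge: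
  assumes "m > 0" "n > 0" "B > 0" and w: "0 \<le> w" "w < pi/4" "2 * w * real n = 6/5 * pi * real B"
    and e: "0 \<le> e" "e + 2 * w \<le> pi/2"
  shows "ennreal ((1 - (123/125) ^ B) * ((1 - (1 - e / (pi/2)) ^ m) *
            ((pi/2 - (e + 2 * w)) ^ (m + 2) / ((pi/2) ^ m * ((real m + 1) * (real m + 2))))))
    \<le> (\<integral>\<^sup>+ (p, q, z). ennreal (Theta_star z
            (select_lowest (\<lambda>i. margin_score m p q (z i)) n B)) \<partial>data_measure m n)"
proof -
  \<comment> \<open>The part \<open>e\<close> bounds the opposite angle, and \<open>2 * w\<close>
    becomes the batch radius \<open>w\<close> after halving:
    \<open>(P - y) / 2 \<le> (P + Q) / 2 - w\<close> when \<open>- Q \<le> e\<close>.\<close>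
  define y where "y = e + 2 * w"
  define \<phi> where "\<phi> p q = (Min ((\<lambda>i. p i) ` {..<m}) + Max ((\<lambda>j. q j) ` {..<m})) / 2" for p q :: "nat \<Rightarrow> real"
  \<comment> \<open>The conditions say that some angle of the class has absolute value at most
    \<open>e\<close>.\<close>
  define A A' :: "(nat \<Rightarrow> real) \<Rightarrow> ennreal"
    where "A q = (if \<exists>j\<in>{..<m}. q j \<notin> {x. e < - x} then 1 else 0)"
      and "A' p = (if \<exists>i\<in>{..<m}. p i \<notin> {x. e < x} then 1 else 0)" for p q
  define f f' :: "(nat \<Rightarrow> real) \<Rightarrow> ennreal"
    where "f p = (INF i\<in>{..<m}. ennreal ((max 0 (p i - y))\<^sup>2))"
      and "f' q = (INF j\<in>{..<m}. ennreal ((max 0 (- q j - y))\<^sup>2))" for p q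
  define g where "g p q = ennreal (1/4) * (f p * A q + A' p * f' q)" for p q
  define C :: "real \<Rightarrow> (nat \<Rightarrow> real) \<Rightarrow> ennreal"
    where "C c z = (if B \<le> (\<Sum>k<n. if \<bar>z k - c\<bar> \<le> w then 1 else 0) then 1 else 0)" for c z
  define G where "G p q z = g p q * C (\<phi> p q) z" for p q z
  let ?a = "1 - (1 - e / (pi/2)) ^ m" and ?\<eta> = "1 - (123/125) ^ B :: real"
  let ?K = "2 * (pi/2 - y) ^ (m + 2) / ((pi/2) ^ m * ((real m + 1) * (real m + 2)))"
  have ne: "{..<m} \<noteq> {}" using assms(1) by (auto simp: lessThan_empty_iff)
  have card_sum: "card {k. k < n \<and> \<bar>z k - c\<bar> \<le> w} = (\<Sum>k<n. if \<bar>z k - c\<bar> \<le> w then 1 else 0)" for z c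
    by (subst sum.inter_filter[symmetric]) (auto intro!: arg_cong[where f = card])
  have [measurable]: "A \<in> borel_measurable (negative_sample m)" "A' \<in> borel_measurable (positive_sample m)"
    "f \<in> borel_measurable (positive_sample m)" "f' \<in> borel_measurable (negative_sample m)"
    "C c \<in> borel_measurable (candidates n)" for c
    unfolding A_def A'_def f_def f'_def C_def by measurable
  have G_meas: "(\<lambda>(p, q, z). G p q z) \<in> borel_measurable (data_measure m n)"
    unfolding G_def g_def C_def \<phi>_def data_measure_def by measurable
  have range_\<phi>: "\<bar>\<phi> p q\<bar> + w \<le> pi/2"
    if "\<forall>i\<in>{..<m}. p i \<in> {0<..pi/2}" "\<forall>i\<in>{..<m}. q i \<in> {-pi/2..<0}" for p q
  proof -
    have "Min ((\<lambda>i. p i) ` {..<m}) \<in> p ` {..<m}" "Max ((\<lambda>j. q j) ` {..<m}) \<in> q ` {..<m}"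
      using ne by (intro Min_in Max_in; force)+
    then obtain i j where "i \<in> {..<m}" "Min ((\<lambda>i. p i) ` {..<m}) = p i"
      and "j \<in> {..<m}" "Max ((\<lambda>j. q j) ` {..<m}) = q j" by (elim imageE)
    then have "Min ((\<lambda>i. p i) ` {..<m}) \<in> {0<..pi/2}" "Max ((\<lambda>j. q j) ` {..<m}) \<in> {-pi/2..<0}"
      using that by (simp_all only:)
    then have "\<bar>\<phi> p q\<bar> \<le> pi/4" unfolding \<phi>_def abs_le_iff by (auto simp: field_simps)
    then show ?thesis using w by simp
  qed
  \<comment> \<open>If both innermost angles are at most \<open>e\<close>, both summands of \<open>g\<close> vanish, so they never overlap.\<close>
  have g_le: "g p q \<le> ennreal ((max 0 (\<bar>\<phi> p q\<bar> - w))\<^sup>2)" for p q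
  proof -
    define P Q where "P = Min ((\<lambda>i. p i) ` {..<m})" and "Q = Max ((\<lambda>j. q j) ` {..<m})"
    have "P \<in> p ` {..<m}" "Q \<in> q ` {..<m}"
      unfolding P_def Q_def using ne by (intro Min_in Max_in; force)+
    then obtain i0 j0 where i0: "i0 \<in> {..<m}" "P = p i0" and j0: "j0 \<in> {..<m}" "Q = q j0" by (elim imageE)
    have f1: "f p \<le> ennreal ((max 0 (P - y))\<^sup>2)"
      unfolding f_def i0(2) by (rule INF_lower[OF i0(1)])
    have f2: "f' q \<le> ennreal ((max 0 (- Q - y))\<^sup>2)"
      unfolding f'_def j0(2) by (rule INF_lower[OF j0(1)])
    have A1: "A q = 0" if "e < - Q"
    proof -
      have "q j \<le> Q" if "j \<in> {..<m}" for j using that by (auto simp: Q_def)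
      then show ?thesis using that by (force simp: A_def)
    qed
    have A2: "A' p = 0" if "e < P"
    proof -
      have "P \<le> p j" if "j \<in> {..<m}" for j using that by (auto simp: P_def)
      then show ?thesis using that by (force simp: A'_def)
    qed
    have Ale: "A q \<le> 1" "A' p \<le> 1" by (auto simp: A_def A'_def)
    have ey: "e \<le> y" using w by (simp add: y_def)
    consider "P \<le> e" "- Q \<le> e" | "e < P" "- Q \<le> e" | "P \<le> e" "e < - Q" | "e < P" "e < - Q" by linarith
    then show ?thesis
    proof cases
      case 1
      then have "max 0 (P - y) = 0" "max 0 (- Q - y) = 0" using ey by auto
      then have "f p = 0" "f' q = 0" using f1 f2 by auto
      then show ?thesis by (simp add: g_def)
    next
      case 2
      have "g p q = ennreal (1/4) * (f p * A q)" using A2[OF 2(1)] by (simp add: g_def)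
      also have "\<dots> \<le> ennreal (1/4) * (ennreal ((max 0 (P - y))\<^sup>2) * 1)"
        using f1 Ale by (intro mult_left_mono mult_mono) auto
      also have "\<dots> = ennreal ((max 0 ((P - y) / 2))\<^sup>2)" by (simp only: mult_1_right quarter_square)
      also have "\<dots> \<le> ennreal ((max 0 (\<bar>\<phi> p q\<bar> - w))\<^sup>2)"
      proof (intro ennreal_leI power_mono max.mono order_refl)
        have "(P - y) / 2 \<le> (P + Q) / 2 - w" using 2 by (simp add: y_def field_simps)
        then show "(P - y) / 2 \<le> \<bar>\<phi> p q\<bar> - w" unfolding \<phi>_def P_def[symmetric] Q_def[symmetric] by linarith
      qed auto
      finally show ?thesis .
    next
      case 3
      have "g p q = ennreal (1/4) * (f' q * A' p)" using A1[OF 3(2)] by (simp add: g_def mult.commute)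
      also have "\<dots> \<le> ennreal (1/4) * (ennreal ((max 0 (- Q - y))\<^sup>2) * 1)"
        using f2 Ale by (intro mult_left_mono mult_mono) auto
      also have "\<dots> = ennreal ((max 0 ((- Q - y) / 2))\<^sup>2)" by (simp only: mult_1_right quarter_square)
      also have "\<dots> \<le> ennreal ((max 0 (\<bar>\<phi> p q\<bar> - w))\<^sup>2)"
      proof (intro ennreal_leI power_mono max.mono order_refl)
        have "(- Q - y) / 2 \<le> - ((P + Q) / 2) - w" using 3 by (simp add: y_def field_simps)
        then show "(- Q - y) / 2 \<le> \<bar>\<phi> p q\<bar> - w" unfolding \<phi>_def P_def[symmetric] Q_def[symmetric] by linarith
      qed auto
      finally show ?thesis .
    next
      case 4
      then show ?thesis using A1 A2 by (simp add: g_def)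
    qed
  qed
  have A_ge: "ennreal ?a \<le> (\<integral>\<^sup>+q. A q \<partial>negative_sample m)"
    unfolding A_def
  proof (rule expected_some_outside_ge[OF prob_space_negative])
    have "emeasure (uniform_measure lborel {-pi/2..<0}) {x. e < - x} \<le> ennreal ((pi/2 - e) / (pi/2))"
      by (rule emeasure_uniform_le[where Y = "{-pi/2..-e}"]) (use e w in auto)
    then show "emeasure (uniform_measure lborel {-pi/2..<0}) {x. e < - x} \<le> ennreal (1 - e / (pi/2))"
      by (simp add: diff_divide_distrib)
  qed (use e w in \<open>auto simp: field_simps\<close>)
  have A'_ge: "ennreal ?a \<le> (\<integral>\<^sup>+p. A' p \<partial>positive_sample m)"
    unfolding A'_def
  proof (rule expected_some_outside_ge[OF prob_space_positive])
    have "emeasure (uniform_measure lborel {0<..pi/2}) {x. e < x} \<le> ennreal ((pi/2 - e) / (pi/2))"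
      by (rule emeasure_uniform_le[where Y = "{e..pi/2}"]) (use e w in auto)
    then show "emeasure (uniform_measure lborel {0<..pi/2}) {x. e < x} \<le> ennreal (1 - e / (pi/2))"
      by (simp add: diff_divide_distrib)
  qed (use e w in \<open>auto simp: field_simps\<close>)
  have y: "0 \<le> y" "y \<le> pi/2" using e w by (auto simp: y_def)
  have f_ge: "ennreal ?K \<le> (\<integral>\<^sup>+p. f p \<partial>positive_sample m)"
    unfolding f_def by (rule expected_min_positive_ge[OF y assms(1)])
  have f'_ge: "ennreal ?K \<le> (\<integral>\<^sup>+q. f' q \<partial>negative_sample m)"
    unfolding f'_def by (rule expected_min_negative_ge[OF y assms(1)])
  have K: "0 \<le> ?K" using y by simp
  have a: "0 \<le> ?a"
  proof -
    have "(1 - e / (pi/2)) ^ m \<le> 1" using e w by (intro power_le_one) (auto simp: field_simps)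
    then show ?thesis by simp
  qed
  have \<eta>: "0 \<le> ?\<eta>" by (simp add: power_le_one)
  have "ennreal (?\<eta> * (?a * (?K / 2))) = ennreal ?\<eta> * (ennreal (1/4) * (ennreal ?K * ennreal ?a + ennreal ?a * ennreal ?K))"
    by (rule ennreal_symmetric_product[OF \<eta> a K])
  also have "\<dots> \<le> ennreal ?\<eta> * (ennreal (1/4) * ((\<integral>\<^sup>+p. f p \<partial>positive_sample m) * (\<integral>\<^sup>+q. A q \<partial>negative_sample m) +
      (\<integral>\<^sup>+p. A' p \<partial>positive_sample m) * (\<integral>\<^sup>+q. f' q \<partial>negative_sample m)))"
    using A_ge A'_ge f_ge f'_ge by (intro mult_left_mono add_mono mult_mono) auto
  also have "\<dots> = (\<integral>\<^sup>+p. (\<integral>\<^sup>+q. ennreal ?\<eta> * g p q \<partial>negative_sample m) \<partial>positive_sample m)"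
  proof -
    have "(\<integral>\<^sup>+q. ennreal ?\<eta> * g p q \<partial>negative_sample m) = ennreal ?\<eta> * (ennreal (1/4) *
       (f p * (\<integral>\<^sup>+q. A q \<partial>negative_sample m) + A' p * (\<integral>\<^sup>+q. f' q \<partial>negative_sample m)))" for p
      unfolding g_def by (subst nn_integral_cmult, measurable, subst nn_integral_cmult, measurable,
         subst nn_integral_add, measurable, subst nn_integral_cmult, measurable, subst nn_integral_cmult, measurable)
    then show ?thesis
      by (simp only:, subst nn_integral_cmult, measurable, subst nn_integral_cmult, measurable,
         subst nn_integral_add, measurable, subst nn_integral_multc, measurable, subst nn_integral_multc, measurable)
  qed
  also have "\<dots> \<le> (\<integral>\<^sup>+p. (\<integral>\<^sup>+q. (\<integral>\<^sup>+z. G p q z \<partial>candidates n) \<partial>negative_sample m) \<partial>positive_sample m)"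
  proof (rule nn_integral_mono_AE)
    have P: "AE p in positive_sample m. \<forall>i\<in>{..<m}. p i \<in> {0<..pi/2}"
      by (rule AE_PiM_uniform[OF _ prob_space_positive]) simp
    show "AE p in positive_sample m. (\<integral>\<^sup>+q. ennreal ?\<eta> * g p q \<partial>negative_sample m)
       \<le> (\<integral>\<^sup>+q. (\<integral>\<^sup>+z. G p q z \<partial>candidates n) \<partial>negative_sample m)"
      using P
    proof eventually_elim
      fix p assume p: "\<forall>i\<in>{..<m}. p i \<in> {0<..pi/2}"
      have Q: "AE q in negative_sample m. \<forall>i\<in>{..<m}. q i \<in> {-pi/2..<0}"
        by (rule AE_PiM_uniform[OF _ prob_space_negative]) simp
      show "(\<integral>\<^sup>+q. ennreal ?\<eta> * g p q \<partial>negative_sample m)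
        \<le> (\<integral>\<^sup>+q. (\<integral>\<^sup>+z. G p q z \<partial>candidates n) \<partial>negative_sample m)"
      proof (rule nn_integral_mono_AE, use Q in eventually_elim)
        fix q assume q: "\<forall>i\<in>{..<m}. q i \<in> {-pi/2..<0}"
        have "(\<integral>\<^sup>+z. C c z \<partial>candidates n) =
           emeasure (candidates n) {z \<in> space (candidates n). B \<le> card {k. k < n \<and> \<bar>z k - c\<bar> \<le> w}}" for c
        proof -
          have "(\<integral>\<^sup>+z. C c z \<partial>candidates n) =
            (\<integral>\<^sup>+z. indicator {z \<in> space (candidates n). B \<le> card {k. k < n \<and> \<bar>z k - c\<bar> \<le> w}} z \<partial>candidates n)"
            by (intro nn_integral_cong) (auto simp: C_def card_sum indicator_def)
          also have "\<dots> = emeasure (candidates n) {z \<in> space (candidates n). B \<le> card {k. k < n \<and> \<bar>z k - c\<bar> \<le> w}}"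
            unfolding card_sum by (rule nn_integral_indicator) measurable
          finally show ?thesis .
        qed
        \<comment> \<open>Given the training angles, the direction is fixed, and the bound on the
          candidate count is uniform in it.\<close>
        then have "ennreal ?\<eta> \<le> (\<integral>\<^sup>+z. C (\<phi> p q) z \<partial>candidates n)"
          using expected_enough_ge[OF w(1) range_\<phi>[OF p q] assms(2) w(3)] by (simp only:)
        then have "g p q * ennreal ?\<eta> \<le> g p q * (\<integral>\<^sup>+z. C (\<phi> p q) z \<partial>candidates n)"
          by (intro mult_left_mono) auto
        also have "\<dots> = (\<integral>\<^sup>+z. G p q z \<partial>candidates n)"
          unfolding G_def by (rule nn_integral_cmult[symmetric]) measurable
        finally show "ennreal ?\<eta> * g p q \<le> (\<integral>\<^sup>+z. G p q z \<partial>candidates n)" by (simp only: mult.commute)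
      qed
    qed
  qed
  also have "\<dots> = (\<integral>\<^sup>+ (p, q, z). G p q z \<partial>data_measure m n)"
    by (rule nn_integral_data_measure[OF G_meas, symmetric])
  also have "\<dots> \<le> (\<integral>\<^sup>+ (p, q, z). ennreal (Theta_star z
            (select_lowest (\<lambda>i. margin_score m p q (z i)) n B)) \<partial>data_measure m n)"
  proof (rule nn_integral_mono_AE, use AE_data_measure[of m n] in eventually_elim, clarify)
    fix p q z assume rng: "\<forall>i\<in>{..<m}. p i \<in> {0<..pi/2}" "\<forall>i\<in>{..<m}. q i \<in> {-pi/2..<0}"
      "\<forall>k\<in>{..<n}. z k \<in> {-pi/2..pi/2}"
    show "G p q z \<le> ennreal (Theta_star z (select_lowest (\<lambda>i. margin_score m p q (z i)) n B))"
    proof (cases "B \<le> card {k. k < n \<and> \<bar>z k - \<phi> p q\<bar> \<le> w}")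
      case True
      then have "G p q z = g p q" by (simp add: G_def C_def card_sum)
      also have "\<dots> \<le> ennreal ((max 0 (\<bar>\<phi> p q\<bar> - w))\<^sup>2)" by (rule g_le)
      also have "\<dots> \<le> ennreal (Theta_star z (select_lowest (\<lambda>i. margin_score m p q (z i)) n B))"
        using True unfolding \<phi>_def
        by (intro ennreal_leI Theta_star_margin_ge) (use rng assms(1-3) w in auto)
      finally show ?thesis .
    next
      case False
      then have "G p q z = 0" by (simp add: G_def C_def card_sum)
      then show ?thesis by simp
    qed
  qed
  finally show ?thesis by (simp add: y_def)
qed

subsection \<open>Comparison of the two bounds\<close>

text \<open>Equality holds at 16. In the step, the lower-order terms of \<open>(Suc k) ^ 4\<close>
  add up to at most \<open>15 * k ^ 3\<close>, below \<open>k ^ 4\<close>.\<close>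

lemma power4_le_two_power: "(m::nat) \<ge> 16 \<Longrightarrow> m ^ 4 \<le> 2 ^ m"
proof (induction m rule: dec_induct)
  case (step k)
  have "k \<ge> 16" using step by simp
  then have "k * k ^ 3 \<ge> 16 * k ^ 3" by (intro mult_right_mono) auto
  moreover have "k ^ 3 \<ge> k ^ 2" "k ^ 3 \<ge> k" "k ^ 3 \<ge> 1"
    using \<open>k \<ge> 16\<close> by (auto intro: power_increasing self_le_power)
  moreover have "(Suc k) ^ 4 = k * k ^ 3 + 4 * k ^ 3 + 6 * k ^ 2 + 4 * k + 1"
    by (simp add: power4_eq_xxxx power3_eq_cube power2_eq_square algebra_simps)
  ultimately have "(Suc k) ^ 4 \<le> 2 * (k * k ^ 3)" by linarith
  also have "k * k ^ 3 = k ^ 4" by (simp add: power4_eq_xxxx power3_eq_cube)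
  finally show ?case using step.IH by simp
qed simp

text \<open>The reverse of \<open>power_one_minus_le_exp\<close>, from applying
  \<open>1 + u \<le> exp u\<close> to the reciprocal
  \<open>1 / (1 - x) = 1 + x / (1 - x)\<close>.\<close>

lemma power_one_minus_ge_exp:
  fixes x :: real
  assumes "0 \<le> x" "x < 1"
  shows "exp (- (x / (1 - x)) * real k) \<le> (1 - x) ^ k"
proof -
  have "1 / (1 - x) = 1 + x / (1 - x)" using assms by (simp add: field_simps)
  also have "\<dots> \<le> exp (x / (1 - x))" by (rule exp_ge_add_one_self)
  finally have "exp (- (x / (1 - x))) \<le> 1 - x" using assms by (simp add: exp_minus field_simps)
  then have "exp (- (x / (1 - x))) ^ k \<le> (1 - x) ^ k" by (intro power_mono) auto
  then show ?thesis by (simp add: exp_of_nat_mult[symmetric] mult.commute)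
qed

lemma exp_minus_mult_ln:
  assumes "M > 0"
  shows "exp (- (real k * ln M)) = 1 / M ^ k"
  using assms by (simp add: exp_minus exp_of_nat_mult field_simps)

theorem theorem1:
  fixes m B n :: nat and \<beta> :: real
  assumes "\<beta> \<ge> 1 / real m"
    and "real n \<ge> 12 * real B * real m"
    and "real B \<ge> 3 * (real m)\<^sup>2 * ln (real m)"
    and "m \<ge> 100"
  shows "(\<integral>\<^sup>+ (p, q, z). ennreal (Theta_star z
            (select_lowest (\<lambda>i. min_margin_score m \<beta> p q (z i)) n B)) \<partial>data_measure m n)
       < (\<integral>\<^sup>+ (p, q, z). ennreal (Theta_star z
            (select_lowest (\<lambda>i. margin_score m p q (z i)) n B)) \<partial>data_measure m n)"
proof -
  define M L b N where "M = real m" and "L = ln M" and "b = real B" and "N = real n"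
  have M: "M \<ge> 100" using assms(4) by (simp add: M_def)
  have L: "L > 0" using M by (simp add: L_def)
  have M2: "M\<^sup>2 \<ge> 10000" using power_mono[of 100 M 2] M by simp
  have bL: "b \<ge> 3 * M\<^sup>2 * L" using assms(3) by (simp add: b_def M_def L_def)
  have "3 * M\<^sup>2 * L > 0" using M L by simp
  then have b: "b > 0" using bL by linarith
  have NbM: "N \<ge> 12 * b * M" using assms(2) by (simp add: N_def b_def M_def)
  have "12 * b * M > 0" using b M by simp
  then have N: "N > 0" using NbM by linarith
  have pos: "m > 0" "n > 0" "B > 0" using M b N by (auto simp: M_def b_def N_def)
  have bN: "b / N \<le> 1 / (12 * M)" using NbM N M by (simp add: field_simps)

  \<comment> \<open>\<open>d\<close> and \<open>w\<close> make the expected candidate counts \<open>9/10 B\<close> (at most) and \<open>6/5 B\<close>; \<open>e\<close> is close to the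
    median of the smallest of \<open>m\<close> angles.\<close>
  define d where "d = 9/20 * pi * b / (N * M\<^sup>2)"
  define w where "w = 3/5 * pi * b / N"
  define e where "e = (pi/2) * (7 / (10 * M))"
  define h where "h = (pi/2)\<^sup>2"
  define X where "X = (M + 1) * (M + 2)"
  have h: "h > 0" by (simp add: h_def)
  have X: "X > 0" using M by (simp add: X_def)

  have d0: "0 \<le> d" using b N by (simp add: d_def)
  have d_le: "d \<le> pi/2 * (3 / (40 * M ^ 3))"
  proof -
    have "d = 9/20 * pi / M\<^sup>2 * (b / N)" by (simp add: d_def)
    also have "\<dots> \<le> 9/20 * pi / M\<^sup>2 * (1 / (12 * M))" using bN by (intro mult_left_mono) auto
    also have "\<dots> = pi/2 * (3 / (40 * M ^ 3))" using M by (simp add: field_simps power2_eq_square power3_eq_cube)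
    finally show ?thesis .
  qed
  have M3: "M ^ 3 \<ge> 1000000" using power_mono[of 100 M 3] M by simp
  have d1: "d < pi/4"
  proof -
    have "3 / (40 * M ^ 3) < 1/2" by (subst pos_divide_less_eq) (use M M3 in auto)
    then have "pi/2 * (3 / (40 * M ^ 3)) < pi/2 * (1/2)" by (intro mult_strict_left_mono) auto
    then show ?thesis using d_le by simp
  qed
  have w0: "0 \<le> w" using b N by (simp add: w_def)
  have w_le: "w \<le> pi/2 * (1 / (10 * M))"
  proof -
    have "w = 3/5 * pi * (b / N)" by (simp add: w_def)
    also have "\<dots> \<le> 3/5 * pi * (1 / (12 * M))" using bN by (intro mult_left_mono) auto
    also have "\<dots> = pi/2 * (1 / (10 * M))" using M by (simp add: field_simps)
    finally show ?thesis .
  qed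
  have y_le: "e + 2 * w \<le> pi/2 * (9 / (10 * M))"
  proof -
    have "e + 2 * w \<le> (pi/2) * (7 / (10 * M)) + 2 * (pi/2 * (1 / (10 * M)))" using w_le by (simp add: e_def)
    also have "\<dots> = pi/2 * (9 / (10 * M))" using M by (simp add: field_simps)
    finally show ?thesis .
  qed
  have w1: "w < pi/4"
  proof -
    have "1 / (10 * M) < 1/2" using M by (simp add: field_simps)
    then have "pi/2 * (1 / (10 * M)) < pi/2 * (1/2)" by (intro mult_strict_left_mono) auto
    then show ?thesis using w_le by simp
  qed
  have M9: "9 / (10 * M) < 1" using M by (simp add: field_simps)
  have y1: "e + 2 * w \<le> pi/2"
  proof -
    have "pi/2 * (9 / (10 * M)) \<le> pi/2 * 1" using M9 by (intro mult_left_mono) auto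
    then show ?thesis using y_le by simp
  qed
  have e0: "0 \<le> e" using M by (simp add: e_def)

  have small1: "(123/125) ^ B \<le> 1 / M ^ 3"
  proof -
    have "(123/125::real) ^ B = (1 - 2/125) ^ B" by simp
    also have "\<dots> \<le> exp (- (2/125) * b)" unfolding b_def by (rule power_one_minus_le_exp) simp
    also have "\<dots> \<le> exp (- (real 3 * L))"
    proof -
      have "3 * L \<le> 2/125 * (3 * M\<^sup>2 * L)" using M2 L by simp
      also have "\<dots> \<le> 2/125 * b" using bL by (intro mult_left_mono) auto
      finally show ?thesis by simp
    qed
    also have "\<dots> = 1 / M ^ 3" unfolding L_def using M by (intro exp_minus_mult_ln) simp
    finally show ?thesis .
  qed
  \<comment> \<open>Crowding: the base \<open>9/10 * exp (1/10)\<close> is below one by only about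
    \<open>1/1000\<close>, but \<open>b\<close> is at least \<open>3 * M\<^sup>2 * L\<close> with
    \<open>M\<^sup>2 \<ge> 10000\<close>.\<close>
  have small2: "1 / (10/9) ^ B * exp (1/9 * (M\<^sup>2 * (2 * d / pi)) * N) \<le> 1 / M ^ 3"
  proof -
    have "1/9 * (M\<^sup>2 * (2 * d / pi)) * N = 1/10 * b" using N M by (simp add: d_def)
    then have "1 / (10/9) ^ B * exp (1/9 * (M\<^sup>2 * (2 * d / pi)) * N) = (9/10) ^ B * exp (1/10) ^ B"
      by (simp add: b_def exp_of_nat_mult[symmetric] mult.commute power_divide)
    also have "\<dots> = (9/10 * exp (1/10)) ^ B" by (rule power_mult_distrib[symmetric])
    also have "\<dots> \<le> (1 - 1/1000) ^ B"
    proof (intro power_mono)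
      have "exp (1/10 :: real) \<le> 1 + 1/10 + (1/10)\<^sup>2" by (rule exp_bound) auto
      then show "9/10 * exp (1/10) \<le> (1 - 1/1000 :: real)" by (simp add: power2_eq_square)
    qed simp
    also have "\<dots> \<le> exp (- (1/1000) * b)" unfolding b_def by (rule power_one_minus_le_exp) simp
    also have "\<dots> \<le> exp (- (real 3 * L))"
    proof -
      have "3 * L \<le> 1/1000 * (3 * M\<^sup>2 * L)" using M2 L by simp
      also have "\<dots> \<le> 1/1000 * b" using bL by (intro mult_left_mono) auto
      finally show ?thesis by simp
    qed
    also have "\<dots> = 1 / M ^ 3" unfolding L_def using M by (intro exp_minus_mult_ln) simp
    finally show ?thesis .
  qed
  \<comment> \<open>The constant 3 in the bound on \<open>B\<close> matters here:
    \<open>9/10 * 3 = 2 + 7/10\<close>. The \<open>2\<close> gives \<open>1 / M\<^sup>2\<close>, and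
    the surplus gives \<open>1/25\<close> because \<open>25 ^ 5 \<le> 10 ^ 7\<close> and
    \<open>M \<ge> 100\<close>.\<close>
  have small3: "exp (- (2 * d / pi) * N) \<le> 1 / (25 * M\<^sup>2)"
  proof -
    have "2 * d / pi * N = 9/10 * (b / M\<^sup>2)" using N M by (simp add: d_def)
    moreover have "3 * L \<le> b / M\<^sup>2" using bL M by (simp add: field_simps)
    ultimately have "2 * L + 7/10 * L \<le> 2 * d / pi * N" by simp
    moreover have "ln 25 \<le> 7/10 * L"
    proof -
      have "5 * ln (25::real) = ln (25 ^ 5)" by (subst ln_realpow) auto
      also have "\<dots> \<le> ln (10 ^ 7)" by simp
      also have "\<dots> = 7 * ln (10::real)" by (subst ln_realpow) auto
      finally have "5 * ln (25::real) \<le> 7 * ln 10" .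
      moreover have "2 * ln (10::real) = ln 100" using ln_realpow[of 10 2] by simp
      moreover have "ln 100 \<le> L" using M by (simp add: L_def)
      ultimately show ?thesis by simp
    qed
    ultimately have "exp (- (2 * d / pi) * N) \<le> exp (- (real 2 * L) + - ln 25)" by simp
    also have "\<dots> = exp (- (real 2 * L)) * exp (- ln 25)" by (rule exp_add)
    also have "\<dots> = 1 / (25 * M\<^sup>2)"
      unfolding L_def by (subst exp_minus_mult_ln) (use M in \<open>auto simp: exp_minus\<close>)
    finally show ?thesis .
  qed
  have small4: "(1/2) ^ m \<le> 1 / M ^ 4"
  proof -
    have "real (m ^ 4) \<le> real (2 ^ m)" using power4_le_two_power[of m] assms(4) by (intro of_nat_mono) simp
    then have "M ^ 4 \<le> 2 ^ m" by (simp add: M_def)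
    then show ?thesis using M by (simp add: power_divide divide_simps)
  qed
  \<comment> \<open>The scaled value \<open>7/10\<close> in \<open>e\<close> slightly exceeds
    \<open>ln 2\<close>; the 64th power provides a rational certificate for
    \<open>exp (7/10) \<ge> 2\<close>.\<close>
  have half: "(1 - e / (pi/2)) ^ m \<le> 1/2"
  proof -
    have eq: "e / (pi/2) = 7 / (10 * M)" by (simp add: e_def)
    have "(1 - 7 / (10 * M)) ^ m \<le> exp (- (7 / (10 * M)) * M)"
      unfolding M_def by (rule power_one_minus_le_exp) (use M in \<open>simp add: M_def field_simps\<close>)
    also have "- (7 / (10 * M)) * M = - (7/10)" using M by simp
    also have "exp (- (7/10)) \<le> (1/2::real)"
    proof -
      have "2 \<le> (1 + 7/10/real 64) ^ 64" by (simp add: power_divide)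
      also have "\<dots> \<le> exp (7/10 :: real)" by (rule exp_ge_one_plus_x_over_n_power_n) auto
      finally show ?thesis by (simp add: exp_minus field_simps)
    qed
    finally show ?thesis unfolding eq .
  qed
  \<comment> \<open>For \<open>M \<ge> 100\<close> the exponent
    \<open>9 * (M + 2) / (10 * M - 9)\<close> is at most \<open>93/100\<close>, so the power stays
    close to \<open>exp (- 9/10)\<close>.\<close>
  have core: "(1 - 9 / (10 * M)) ^ (m + 2) \<ge> 39/100"
  proof -
    have "39/100 \<le> (1 - 93/100/real 64) ^ 64" by (simp add: power_divide)
    also have "\<dots> \<le> exp (- (93/100))" by (rule exp_ge_one_minus_x_over_n_power_n) auto
    also have "\<dots> \<le> exp (- (9 / (10 * M) / (1 - 9 / (10 * M))) * real (m + 2))"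
    proof -
      have "9 / (10 * M) / (1 - 9 / (10 * M)) = 9 / (10 * M - 9)" using M by (simp add: field_simps)
      moreover have "9 / (10 * M - 9) * (M + 2) \<le> 93/100" using M by (simp add: field_simps)
      ultimately show ?thesis by (simp add: M_def add.commute)
    qed
    also have "\<dots> \<le> (1 - 9 / (10 * M)) ^ (m + 2)"
      using M M9 by (intro power_one_minus_ge_exp) auto
    finally show ?thesis .
  qed

  \<comment> \<open>The ratio \<open>X / M\<^sup>2\<close> is largest at \<open>M = 100\<close>,
    where it is \<open>101 * 102 / 10000\<close>.\<close>
  have inv: "1 / M\<^sup>2 \<le> 10302/10000 * (1 / X)" "1 / M ^ 3 \<le> 1/100 * (1 / M\<^sup>2)" "1 / M ^ 3 \<le> 1/1000000"
    "1 / M ^ 4 \<le> 1/10000 * (1 / M\<^sup>2)"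
  proof -
    have "X \<le> 10302/10000 * M\<^sup>2"
    proof -
      have "100 * M \<le> M\<^sup>2" unfolding power2_eq_square using M by (intro mult_right_mono) auto
      moreover have "X = M\<^sup>2 + 3 * M + 2" by (simp add: X_def power2_eq_square algebra_simps)
      ultimately show ?thesis using M by linarith
    qed
    then show "1 / M\<^sup>2 \<le> 10302/10000 * (1 / X)" using X M by (simp add: field_simps)
    show "1 / M ^ 3 \<le> 1/100 * (1 / M\<^sup>2)" using M by (simp add: field_simps power2_eq_square power3_eq_cube)
    show "1 / M ^ 3 \<le> 1/1000000" by (rule frac_le) (use M M3 in auto)
    show "1 / M ^ 4 \<le> 1/10000 * (1 / M\<^sup>2)"
      using M M2 by (simp add: field_simps power2_eq_square power4_eq_xxxx)
  qed

  let ?U = "101/400 * ((pi/2)\<^sup>2 * (1 / (2 * ((real m + 1) * (real m + 2))) + (1/2) ^ m))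
        + 101/400 * (pi/2)\<^sup>2 * (1/2) ^ m + 101 * d\<^sup>2 + (pi/2)\<^sup>2 * exp (- (2 * d / pi) * real n)
        + (pi/2)\<^sup>2 / (10/9) ^ B * exp (1/9 * ((real m)\<^sup>2 * (2 * d / pi)) * real n)"
  let ?L = "(1 - (123/125) ^ B) * ((1 - (1 - e / (pi/2)) ^ m) *
            ((pi/2 - (e + 2 * w)) ^ (m + 2) / ((pi/2) ^ m * ((real m + 1) * (real m + 2)))))"

  have U: "?U \<le> h * (190/1000 * (1 / X))"
  proof -
    have "?U = 101/400 * (h * (1 / (2 * X) + (1/2) ^ m)) + 101/400 * h * (1/2) ^ m + 101 * d\<^sup>2
       + h * exp (- (2 * d / pi) * N) + h * (1 / (10/9) ^ B * exp (1/9 * (M\<^sup>2 * (2 * d / pi)) * N))"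
      by (simp add: h_def X_def M_def N_def)
    also have "\<dots> \<le> 101/400 * (h * (1 / (2 * X) + 1 / M ^ 4)) + 101/400 * h * (1 / M ^ 4) + 101 * (h * (1 / M ^ 4))
       + h * (1 / (25 * M\<^sup>2)) + h * (1 / M ^ 3)"
    proof (intro add_mono mult_left_mono order_refl small2 small3 small4)
      have "d\<^sup>2 \<le> (pi/2 * (3 / (40 * M ^ 3)))\<^sup>2" using d_le d0 by (intro power_mono)
      also have "\<dots> \<le> (pi/2 * (1 / M\<^sup>2))\<^sup>2"
      proof (intro power_mono mult_left_mono)
        show "3 / (40 * M ^ 3) \<le> 1 / M\<^sup>2" using M by (simp add: field_simps power2_eq_square power3_eq_cube)
      qed (use M in auto)
      also have "\<dots> = h * (1 / M ^ 4)" unfolding power_mult_distrib h_def by (simp add: power_divide)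
      finally show "d\<^sup>2 \<le> h * (1 / M ^ 4)" .
    qed (use h in auto)
    \<comment> \<open>The coefficient \<open>20301/200\<close> collects the three terms in
      \<open>1 / M ^ 4\<close>: twice \<open>101/400\<close>, plus \<open>101\<close> from the
      radius.\<close>
    also have "\<dots> = h * (101/800 * (1 / X) + 20301/200 * (1 / M ^ 4) + 1/25 * (1 / M\<^sup>2) + 1 / M ^ 3)"
      using X M by (simp add: field_simps)
    also have "\<dots> \<le> h * (190/1000 * (1 / X))"
    proof (intro mult_left_mono)
      have lin: "101/800 * r + 20301/200 * v + 1/25 * s + u \<le> 190/1000 * r"
        if "0 \<le> r" "s \<le> 10302/10000 * r" "u \<le> 1/100 * s" "v \<le> 1/10000 * s" for r s u v :: real
        using that by linarith
      show "101/800 * (1 / X) + 20301/200 * (1 / M ^ 4) + 1/25 * (1 / M\<^sup>2) + 1 / M ^ 3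
        \<le> 190/1000 * (1 / X)" by (rule lin) (use X inv in auto)
    qed (use h in simp)
    finally show ?thesis .
  qed
  have Lo: "h * (1949/10000 * (1 / X)) \<le> ?L" 
  proof -
    have "pi/2 * (1 - 9 / (10 * M)) \<le> pi/2 - (e + 2 * w)" using y_le by (simp add: algebra_simps)
    then have "(pi/2 * (1 - 9 / (10 * M))) ^ (m + 2) \<le> (pi/2 - (e + 2 * w)) ^ (m + 2)"
      using M9 by (intro power_mono) auto
    then have "(pi/2 * (1 - 9 / (10 * M))) ^ (m + 2) / ((pi/2) ^ m * X) \<le>
       (pi/2 - (e + 2 * w)) ^ (m + 2) / ((pi/2) ^ m * X)" using X by (intro divide_right_mono) auto
    moreover have "(pi/2 * (1 - 9 / (10 * M))) ^ (m + 2) / ((pi/2) ^ m * X)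
       = h * (1 / X) * (1 - 9 / (10 * M)) ^ (m + 2)"
    proof -
      have "(pi/2 * (1 - 9 / (10 * M))) ^ (m + 2) = (pi/2) ^ m * h * (1 - 9 / (10 * M)) ^ (m + 2)"
        unfolding power_mult_distrib h_def power_add[of "pi/2"] by (rule refl)
      moreover have cancel: "c * h * a / (c * X) = h * (1 / X) * a" if "c \<noteq> 0" for a c :: real
        using that by simp
      ultimately show ?thesis by (simp only:) (rule cancel, simp)
    qed
    moreover have "h * (1 / X) * (39/100) \<le> h * (1 / X) * (1 - 9 / (10 * M)) ^ (m + 2)"
      using core h X by (intro mult_left_mono) auto
    ultimately have 1: "h * (1 / X) * (39/100) \<le> (pi/2 - (e + 2 * w)) ^ (m + 2) / ((pi/2) ^ m * X)" by linarith
    \<comment> \<open>The three factors come from the candidate count, the probability of an angle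
      within \<open>e\<close>, and the power estimate; their product slightly exceeds
      \<open>0.1949\<close>.\<close>
    have "1949/10000 * (h * (1 / X)) \<le> 999999/1000000 * (1/2 * (h * (1 / X) * (39/100)))"
    proof -
      have lin: "1949/10000 * t \<le> 999999/1000000 * (1/2 * (t * (39/100)))" if "0 \<le> t" for t :: real
        using that by linarith
      show ?thesis by (rule lin) (use h X in simp)
    qed
    also have "\<dots> \<le> (1 - (123/125) ^ B) * ((1 - (1 - e / (pi/2)) ^ m) *
        ((pi/2 - (e + 2 * w)) ^ (m + 2) / ((pi/2) ^ m * X)))"
      using 1 half small1 inv(3) h X by (intro mult_mono mult_nonneg_nonneg) auto
    finally show ?thesis unfolding X_def M_def mult.left_commute[of h "1949/10000"] .
  qed

  have "(\<integral>\<^sup>+ (p, q, z). ennreal (Theta_star z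
            (select_lowest (\<lambda>i. min_margin_score m \<beta> p q (z i)) n B)) \<partial>data_measure m n) \<le> ennreal ?U"
    by (rule expected_min_margin_le[OF assms(1) pos d0 d1])
  also have "\<dots> < ennreal ?L"
  proof (rule ennreal_lessI)
    have "h * (190/1000 * (1 / X)) < h * (1949/10000 * (1 / X))"
      using h X by (intro mult_strict_left_mono mult_strict_right_mono) auto
    then show "?U < ?L" using U Lo by linarith
    have "0 < h * (1949/10000 * (1 / X))"
      using h X by simp
    then show "0 < ?L" using Lo by linarith
  qed
  also have "\<dots> \<le> (\<integral>\<^sup>+ (p, q, z). ennreal (Theta_star z
            (select_lowest (\<lambda>i. margin_score m p q (z i)) n B)) \<partial>data_measure m n)"
  proof (rule expected_margin_ge[OF pos w0 w1 _ e0 y1])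
    show "2 * w * real n = 6/5 * pi * real B" using N by (simp add: w_def N_def b_def)
  qed
  finally show ?thesis .
qed

end
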